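(* Let $\mathcal{A}_G$ be the graphic arrangement in $\mathbb{K}^\ell$ of a simple graph $G$ with vertex set $[\ell]=\{1,\dots,\ell\}$. Let $R=\mathbb{K}[x_i-x_j\mid 1\le i<j\le\ell]\subset S=\mathbb{K}[x_1,\dots,x_\ell]$ and $$\Omega^1_R(\mathcal{A}_G)=\Omega^1(\mathcal{A}_G)\cap\Big(\bigoplus_{i=1}^\ell\frac{1}{Q(\mathcal{A}_G)}R\,dx_i\Big).$$ Then $$\Omega^1_R(\mathcal{A}_G)\cong J(G^c)/(x_1\cdots x_\ell)$$ as $R$-modules, where $G^c$ is the complementary graph of $G$ and $J(G^c)$ is its cover ideal.
   Context: Let $\mathbb{K}$ be a field, $V=\mathbb{K}^\ell$ and $S=\mathbb{K}[x_1,\dots,x_\ell]$, where $x_1,\dots,x_\ell$ are the coordinate functions. For a simple graph $G$ with vertex set $[\ell]$ and edge set $E(G)$, the graphic arrangement is $\mathcal{A}_G=\{\{x_u=x_v\}\mid\{u,v\}\in E(G)\}$. For a finite set $\mathcal{A}$ of linear hyperplanes in $V$, $\alpha_H\in V^*$ denotes a defining linear form of $H\in\mathcal{A}$ and $Q(\mathcal{A})=\prod_{H\in\mathcal{A}}\alpha_H$. For graphic arrangements take the defining forms $x_u-x_v$, so $Q(\mathcal{A}_G)\in R$. Let $\Omega_V^1=\bigoplus_i S\,dx_i$, $\Omega_V^2=\bigwedge^2\Omega_V^1$, and for $\alpha=\sum c_ix_i$ let $d\alpha=\sum c_i\,dx_i$. Define $$\Omega^1(\mathcal{A})=\{\omega\in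 \tfrac{1}{Q(\mathcal{A})}\Omega^1_V \mid Q(\mathcal{A})\,\omega\wedge d\alpha_H\in\alpha_H\Omega_V^2\ \text{for all } H\in\mathcal{A}\}.$$ The complementary graph $G^c$ has vertex set $[\ell]$ and its edges are the two-element subsets of $[\ell]$ that are not edges of $G$. The cover ideal of a graph $\Gamma$ on $[\ell]$ is the ideal $J(\Gamma)=\bigcap_{\{u,v\}\in E(\Gamma)}(x_u,x_v)$ of $S$ (equal to $S$ if $\Gamma$ has no edges). The $S$-module $J(G^c)/(x_1\cdots x_\ell)$ is viewed as an $R$-module via $R\subset S$. *)

theory Defs
  imports
    "HOL-Analysis.Finite_Cartesian_Product"
    "HOL-Library.Poly_Mapping"
    "HOL-Computational_Algebra.Polynomial_Factorial"
    "HOL-Algebra.Algebra"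
    "HOL-Algebra.Algebraic_Closure_Type"
begin

text \<open>
  The index set $[\ell]$ is a finite linearly ordered type \<open>'n\<close>, so $\ell$ is \<open>CARD('n)\<close>,
  $V = K^\ell$ is \<open>'k^'n\<close>, and the type \<open>('k, 'n) mpol\<close> is all of
  $S = K[x_1,\dots,x_\ell]$ (finitely supported maps from exponent vectors to coefficients).
  The linear order is what makes the library provide the \<open>idom\<close> instance for \<open>mpol\<close>, and hence
  its field of fractions.
\<close>

type_synonym ('k, 'n) mpol = "('n \<Rightarrow>\<^sub>0 nat) \<Rightarrow>\<^sub>0 'k"

type_synonym ('k, 'n) vect = "'k ^ 'n"

definition Const :: "'k::field \<Rightarrow> ('k, 'n) mpol"
  where "Const c = Poly_Mapping.single 0 c"

definition Var :: "'n \<Rightarrow> ('k::field, 'n) mpol"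
  where "Var i = Poly_Mapping.single (Poly_Mapping.single i 1) 1"

abbreviation mpol_ring :: "('k::field, 'n) mpol ring"
  where "mpol_ring \<equiv> ring_of_type_algebra"

text \<open>The subring $R = K[x_i - x_j \mid i < j]$ of $S$.\<close>

definition diff_ring :: "('k::field, 'n::{finite,linorder}) mpol ring"
  where "diff_ring = mpol_ring \<lparr> carrier :=
    generate_ring mpol_ring (range Const \<union> {Var i - Var j | i j. i < j}) \<rparr>"


section \<open>Modules\<close>

definition module_iso ::
    "('a, 'r) ring_scheme \<Rightarrow> ('a, 'b, 'm) module_scheme \<Rightarrow> ('a, 'c, 'n) module_scheme \<Rightarrow> ('b \<Rightarrow> 'c) set"
  where "module_iso R M N = {h. bij_betw h (carrier M) (carrier N) \<and>
    (\<forall>x\<in>carrier M. \<forall>y\<in>carrier M. h (x \<oplus>\<^bsub>M\<^esub> y) = h x \<oplus>\<^bsub>N\<^esub> h y) \<and>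
    (\<forall>r\<in>carrier R. \<forall>x\<in>carrier M. h (r \<odot>\<^bsub>M\<^esub> x) = r \<odot>\<^bsub>N\<^esub> h x)}"

definition module_isomorphic ::
    "('a, 'r) ring_scheme \<Rightarrow> ('a, 'b, 'm) module_scheme \<Rightarrow> ('a, 'c, 'n) module_scheme \<Rightarrow> bool"
  where "module_isomorphic R M N \<longleftrightarrow>
    Module.module R M \<and> Module.module R N \<and> module_iso R M N \<noteq> {}"

text \<open>
  The quotient of a module by a submodule, built from additive cosets. As usual for modules in
  HOL-Algebra, the multiplicative fields inherited from the ring record carry no meaning.
\<close>

definition quot_module :: "('a, 'b, 'm) module_scheme \<Rightarrow> 'b set \<Rightarrow> ('a, 'b set) module"
  where "quot_module M N = \<lparr>
    carrier = a_rcosets\<^bsub>M\<^esub> N,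
    monoid.mult = undefined, one = undefined,
    ring.zero = N,
    add = set_add M,
    module.smult = (\<lambda>r C. \<Union>x\<in>C. N +>\<^bsub>M\<^esub> (r \<odot>\<^bsub>M\<^esub> x)) \<rparr>"


section \<open>Logarithmic forms of hyperplane arrangements\<close>

text \<open>
  The vector \<open>c\<close> stands for the linear form $\sum_i c_i x_i \in V^*$. A rational 1-form
  $\sum_i \omega_i\,dx_i$ is the vector of its coefficients in the fraction field of $S$.
\<close>

definition linear_form :: "('k::field, 'n::finite) vect \<Rightarrow> ('k, 'n) mpol"
  where "linear_form c = (\<Sum>i\<in>UNIV. Const (c $ i) * Var i)"

type_synonym ('k, 'n) rat_form1 = "('k, 'n) mpol fract ^ 'n"

definition diff_form :: "('k::field, 'n::{finite,linorder}) vect \<Rightarrow> ('k, 'n) rat_form1"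
  where "diff_form c = (\<chi> i. to_fract (Const (c $ i)))"

definition Omega1_V :: "('k::field, 'n::{finite,linorder}) rat_form1 set"
  where "Omega1_V = {\<omega>. \<forall>i. \<omega> $ i \<in> range to_fract}"

text \<open>
  2-forms are alternating matrices: $dx_i \wedge dx_j$ (for $i < j$) is the matrix with
  entry $1$ at $(i,j)$, $-1$ at $(j,i)$ and $0$ elsewhere. The diagonal must be required to vanish
  separately because of characteristic 2.
\<close>

type_synonym ('k, 'n) rat_form2 = "('k, 'n) mpol fract ^ 'n ^ 'n"

definition wedge ::
    "('k::field, 'n::{finite,linorder}) rat_form1 \<Rightarrow> ('k, 'n) rat_form1 \<Rightarrow> ('k, 'n) rat_form2"
  where "wedge \<omega> \<eta> = (\<chi> i j. \<omega> $ i * \<eta> $ j - \<omega> $ j * \<eta> $ i)"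

definition scale2 ::
    "('k::field, 'n::{finite,linorder}) mpol fract \<Rightarrow> ('k, 'n) rat_form2 \<Rightarrow> ('k, 'n) rat_form2"
  where "scale2 c \<theta> = (\<chi> i j. c * \<theta> $ i $ j)"

definition Omega2_V :: "('k::field, 'n::{finite,linorder}) rat_form2 set"
  where "Omega2_V = {\<theta>. (\<forall>i j. \<theta> $ i $ j \<in> range to_fract) \<and>
    (\<forall>i. \<theta> $ i $ i = 0) \<and> (\<forall>i j. \<theta> $ j $ i = - \<theta> $ i $ j)}"

text \<open>
  An arrangement is a finite set \<open>A\<close> of hyperplanes in $V$ together with a choice \<open>\<alpha> H\<close> of
  a defining linear form for every \<open>H \<in> A\<close>.
\<close>

definition defining_poly ::
    "('k::field, 'n::{finite,linorder}) vect set set \<Rightarrow> (('k, 'n) vect set \<Rightarrow> ('k, 'n) vect) \<Rightarrow> ('k, 'n) mpol"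
  where "defining_poly A \<alpha> = (\<Prod>H\<in>A. linear_form (\<alpha> H))"

definition log_forms ::
    "('k::field, 'n::{finite,linorder}) vect set set \<Rightarrow> (('k, 'n) vect set \<Rightarrow> ('k, 'n) vect) \<Rightarrow> ('k, 'n) rat_form1 set"
  where "log_forms A \<alpha> = (let Q = to_fract (defining_poly A \<alpha>) in
    {\<omega> \<in> (\<lambda>\<eta>. inverse Q *s \<eta>) ` Omega1_V.
      \<forall>H\<in>A. scale2 Q (wedge \<omega> (diff_form (\<alpha> H))) \<in> scale2 (to_fract (linear_form (\<alpha> H))) ` Omega2_V})"

definition log_forms_R ::
    "('k::field, 'n::{finite,linorder}) vect set set \<Rightarrow> (('k, 'n) vect set \<Rightarrow> ('k, 'n) vect) \<Rightarrow> ('k, 'n) rat_form1 set"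
  where "log_forms_R A \<alpha> = log_forms A \<alpha> \<inter>
    (\<lambda>\<eta>. inverse (to_fract (defining_poly A \<alpha>)) *s \<eta>) ` {\<eta>. \<forall>i. \<eta> $ i \<in> to_fract ` carrier diff_ring}"

definition log_module_R ::
    "('k::field, 'n::{finite,linorder}) vect set set \<Rightarrow> (('k, 'n) vect set \<Rightarrow> ('k, 'n) vect) \<Rightarrow>
      (('k, 'n) mpol, ('k, 'n) rat_form1) module"
  where "log_module_R A \<alpha> = \<lparr>
    carrier = log_forms_R A \<alpha>,
    monoid.mult = undefined, one = undefined,
    ring.zero = 0,
    add = (+),
    module.smult = (\<lambda>r \<omega>. to_fract r *s \<omega>) \<rparr>"


section \<open>Graphs\<close>

definition simple_graph :: "'n set set \<Rightarrow> bool"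
  where "simple_graph E \<longleftrightarrow> (\<forall>e\<in>E. card e = 2)"

definition compl_graph :: "'n set set \<Rightarrow> 'n set set"
  where "compl_graph E = {e. card e = 2 \<and> e \<notin> E}"

definition diag_hyperplane :: "'n::finite \<Rightarrow> 'n \<Rightarrow> ('k::field, 'n) vect set"
  where "diag_hyperplane u v = {p. p $ u = p $ v}"

definition graphic_arrangement :: "'n::finite set set \<Rightarrow> ('k::field, 'n) vect set set"
  where "graphic_arrangement E = {diag_hyperplane u v | u v. {u, v} \<in> E}"

lemma diag_hyperplane_defining_form:
  fixes u v :: "'n::finite"
  assumes "u \<noteq> v"
  shows "axis u 1 - axis v 1 \<noteq> (0 :: ('k::field, 'n) vect)"
    and "diag_hyperplane u v =
      {p :: ('k::field, 'n) vect. (\<Sum>i\<in>UNIV. (axis u 1 - axis v 1) $ i * p $ i) = 0}"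
proof -
  have "(axis u 1 - axis v 1 :: ('k::field, 'n) vect) $ u = 1"
    using assms by (simp add: axis_def)
  then show "axis u 1 - axis v 1 \<noteq> (0 :: ('k::field, 'n) vect)"
    by (metis zero_index zero_neq_one)
  have "(\<Sum>i\<in>UNIV. (axis u 1 - axis v 1) $ i * p $ i) = p $ u - p $ v" for p :: "('k::field, 'n) vect"
    by (simp add: axis_def left_diff_distrib sum_subtractf if_distrib [of "\<lambda>x. x * _"] cong: if_cong)
  then show "diag_hyperplane u v =
      {p :: ('k::field, 'n) vect. (\<Sum>i\<in>UNIV. (axis u 1 - axis v 1) $ i * p $ i) = 0}"
    by (simp add: diag_hyperplane_def)
qed

text \<open>
  The two possible signs of the form $x_u - x_v$ attached to an edge: both are admissible, as
  edges are unordered.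
\<close>

definition graphic_forms :: "'n::finite set set \<Rightarrow> (('k::field, 'n) vect set \<Rightarrow> ('k, 'n) vect) \<Rightarrow> bool"
  where "graphic_forms E \<alpha> \<longleftrightarrow> (\<forall>u v. {u, v} \<in> E \<longrightarrow>
    \<alpha> (diag_hyperplane u v) \<in> {axis u 1 - axis v 1, axis v 1 - axis u 1})"

definition cover_ideal :: "'n set set \<Rightarrow> ('k::field, 'n) mpol set"
  where "cover_ideal E = (\<Inter>e\<in>E. Idl\<^bsub>mpol_ring\<^esub> (Var ` e))"

definition cover_module :: "'n set set \<Rightarrow> (('k::field, 'n) mpol, ('k, 'n) mpol) module"
  where "cover_module E = \<lparr>
    carrier = cover_ideal E,
    monoid.mult = undefined, one = undefined,
    ring.zero = 0,
    add = (+),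
    module.smult = (*) \<rparr>"

end

theory Submission
  imports Defs
begin

text \<open>
  The isomorphism sends $\omega = \sum_i \omega_i\,dx_i$ to the class of
  $F = \sum_i \omega_i \prod_{j \neq i} x_j$. Since $S = R[x_u]$ and $x_i = x_u + (x_i - x_u)$, this is the
  partial fraction decomposition $F / (x_1 \cdots x_\ell) = \sum_i \omega_i / x_i$ over the fraction field
  of $R$, whose inverse is Lagrange interpolation: the substitution $\tau_u : x_j \mapsto x_j - x_u$ has
  kernel $(x_u)$ and image $R$, and $\tau_u(F) = \omega_u \prod_{j \neq u} (x_j - x_u)$. At an edge $uv$ the
  divisibility conditions on the numerators of $\omega$ say that $F$ has no pole along $x_u = x_v$;
  at a non-edge $uv$, neither $\omega_u$ nor $\omega_v$ has such a pole exactly if $F \in (x_u, x_v)$.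

  All divisibility arguments use that $x_u$, $x_u - x_v$ and $(x_u, x_v)$ are kernels of
  substitution homomorphisms from $S$ to itself, hence prime.
\<close>

no_notation fps_nth (infixl \<open>$\<close> 75)

section \<open>Substitution in polynomials\<close>

lemma Const_0 [simp]: "Const 0 = 0" and Const_1 [simp]: "Const 1 = 1"
  by (simp_all add: Const_def)

lemma Const_add: "Const (a + b) = Const a + Const b"
  by (simp add: Const_def single_add)

lemma Const_mult: "Const (a * b) = Const a * Const b"
  by (simp add: Const_def mult_single)

lemma Const_uminus: "Const (- a) = - Const a"
  by (simp add: Const_def single_uminus)

lemma Var_eq_iff [simp]: "Var i = (Var j :: ('k::field, 'n) mpol) \<longleftrightarrow> i = j"
proof
  assume *: "Var i = (Var j :: ('k, 'n) mpol)"
  have "Poly_Mapping.lookup (Var j :: ('k, 'n) mpol) (Poly_Mapping.single i 1) = 1"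
    unfolding *[symmetric] by (simp add: Var_def)
  then have "Poly_Mapping.single i (1::nat) = Poly_Mapping.single j 1"
    by (simp add: Var_def lookup_single when_def split: if_splits)
  then have "Poly_Mapping.lookup (Poly_Mapping.single j (1::nat)) i = 1"
    by (metis lookup_single_eq)
  then show "i = j"
    by (simp add: lookup_single when_def split: if_splits)
qed simp

lemma Var_neq_0 [simp]: "Var i \<noteq> (0 :: ('k::field, 'n) mpol)"
  by (metis Var_def lookup_single_eq lookup_zero zero_neq_one)

text \<open>The \<open>K\<close>-algebra endomorphism of \<open>S\<close> with
  \<open>x_i \<mapsto> \<phi> i\<close>, evaluated monomial by monomial. With \<open>S\<close>
  itself as the target, kernels are those of maps into a domain.\<close>

definition psubst ::
    "('n::finite \<Rightarrow> ('k::field, 'n) mpol) \<Rightarrow> ('k, 'n) mpol \<Rightarrow> ('k, 'n) mpol"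
  where "psubst \<phi> p =
    (\<Sum>m\<in>Poly_Mapping.keys p. Const (Poly_Mapping.lookup p m) * (\<Prod>i\<in>UNIV. \<phi> i ^ Poly_Mapping.lookup m i))"

text \<open>Cancellation can shrink the support of a sum, so additivity needs one index set that
  serves all the polynomials involved.\<close>

lemma psubst_superset:
  assumes "finite A" "Poly_Mapping.keys p \<subseteq> A"
  shows "psubst \<phi> p = (\<Sum>m\<in>A. Const (Poly_Mapping.lookup p m) * (\<Prod>i\<in>UNIV. \<phi> i ^ Poly_Mapping.lookup m i))"
  unfolding psubst_def using assms
  by (intro sum.mono_neutral_left) (auto simp: in_keys_iff)

lemma psubst_add [simp]: "psubst \<phi> (p + q) = psubst \<phi> p + psubst \<phi> q"
proof -
  have "Poly_Mapping.keys (p + q) \<subseteq> Poly_Mapping.keys p \<union> Poly_Mapping.keys q"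
    by (rule keys_add)
  then show ?thesis
    by (simp add: psubst_superset [where A = "Poly_Mapping.keys p \<union> Poly_Mapping.keys q"] lookup_add Const_add
        distrib_right sum.distrib)
qed

lemma psubst_0 [simp]: "psubst \<phi> 0 = 0"
  by (simp add: psubst_def)

lemma psubst_uminus [simp]: "psubst \<phi> (- p) = - psubst \<phi> p"
  by (metis add.right_inverse psubst_0 psubst_add minus_unique)

lemma psubst_diff [simp]: "psubst \<phi> (p - q) = psubst \<phi> p - psubst \<phi> q"
  by (metis psubst_add psubst_uminus add_uminus_conv_diff)

lemma psubst_sum [simp]: "psubst \<phi> (sum f A) = (\<Sum>x\<in>A. psubst \<phi> (f x))"
  by (induction A rule: infinite_finite_induct) auto

lemma psubst_single:
  "psubst \<phi> (Poly_Mapping.single m c) = Const c * (\<Prod>i\<in>UNIV. \<phi> i ^ Poly_Mapping.lookup m i)"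
  by (subst psubst_superset [where A = "{m}"]) auto

lemma poly_mapping_eq_sum_single:
  "p = (\<Sum>m\<in>Poly_Mapping.keys p. Poly_Mapping.single m (Poly_Mapping.lookup p m))"
  by (rule poly_mapping_eqI) (auto simp: lookup_sum lookup_single when_def in_keys_iff)

text \<open>Both sides are biadditive in \<open>p\<close> and \<open>q\<close>, so it suffices to
  treat two monomials, where exponents add and coefficients multiply.\<close>

lemma psubst_mult [simp]: "psubst \<phi> (p * q) = psubst \<phi> p * psubst \<phi> q"
proof -
  have s: "psubst \<phi> (Poly_Mapping.single m c * Poly_Mapping.single m' c') =
      psubst \<phi> (Poly_Mapping.single m c) * psubst \<phi> (Poly_Mapping.single m' c')" for m m' c c'
    by (simp add: mult_single psubst_single Const_mult lookup_add power_add prod.distrib mult_ac)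
  have "psubst \<phi> (p * q) = psubst \<phi> ((\<Sum>m\<in>Poly_Mapping.keys p. Poly_Mapping.single m (Poly_Mapping.lookup p m)) *
      (\<Sum>m\<in>Poly_Mapping.keys q. Poly_Mapping.single m (Poly_Mapping.lookup q m)))"
    using poly_mapping_eq_sum_single [of p] poly_mapping_eq_sum_single [of q] by simp
  also have "\<dots> = psubst \<phi> (\<Sum>m\<in>Poly_Mapping.keys p. Poly_Mapping.single m (Poly_Mapping.lookup p m)) *
      psubst \<phi> (\<Sum>m\<in>Poly_Mapping.keys q. Poly_Mapping.single m (Poly_Mapping.lookup q m))"
    by (simp only: sum_product psubst_sum s)
  also have "\<dots> = psubst \<phi> p * psubst \<phi> q"
    using poly_mapping_eq_sum_single [of p] poly_mapping_eq_sum_single [of q] by simp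
  finally show ?thesis .
qed

lemma psubst_Const [simp]: "psubst \<phi> (Const c) = Const c"
  unfolding Const_def by (subst psubst_single) (simp add: Const_def)

lemma psubst_1 [simp]: "psubst \<phi> 1 = 1"
  by (metis psubst_Const Const_1)

lemma psubst_Var [simp]: "psubst \<phi> (Var i) = \<phi> i"
proof -
  have "(\<Prod>j\<in>UNIV. \<phi> j ^ Poly_Mapping.lookup (Poly_Mapping.single i 1) j) = (\<Prod>j\<in>{i}. \<phi> j)"
    by (intro prod.mono_neutral_cong_right) (auto simp: lookup_single)
  then show ?thesis
    by (simp add: Var_def psubst_single)
qed

lemma psubst_prod [simp]: "psubst \<phi> (prod f A) = (\<Prod>x\<in>A. psubst \<phi> (f x))"
  by (induction A rule: infinite_finite_induct) auto

lemma Var_power: "Var i ^ k = Poly_Mapping.single (Poly_Mapping.single i k) 1"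
  by (induction k) (auto simp: Var_def mult_single single_add [symmetric])

lemma single_eq_prod_Var:
  fixes m :: "'n::finite \<Rightarrow>\<^sub>0 nat"
  shows "Poly_Mapping.single m c = Const c * (\<Prod>i\<in>UNIV. Var i ^ Poly_Mapping.lookup m i)"
proof -
  have prod_single: "(\<Prod>i\<in>A. Poly_Mapping.single (a i) 1) = Poly_Mapping.single (\<Sum>i\<in>A. a i) 1"
    for A and a :: "'n \<Rightarrow> 'n \<Rightarrow>\<^sub>0 nat"
    by (induction A rule: infinite_finite_induct) (auto simp: mult_single)
  have "(\<Sum>i\<in>UNIV. Poly_Mapping.single i (Poly_Mapping.lookup m i)) = m"
    by (rule poly_mapping_eqI) (auto simp: lookup_sum lookup_single when_def)
  then show ?thesis
    by (simp add: Var_power prod_single Const_def mult_single)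
qed

text \<open>Constants and variables generate \<open>S\<close> as a ring, so properties stable under
  sums and products are checked on these generators.\<close>

lemma mpol_induct [case_names Const Var add mult]:
  fixes p :: "('k::field, 'n::finite) mpol"
  assumes C: "\<And>c. P (Const c)" and V: "\<And>i. P (Var i)"
    and A: "\<And>p q. P p \<Longrightarrow> P q \<Longrightarrow> P (p + q)" and M: "\<And>p q. P p \<Longrightarrow> P q \<Longrightarrow> P (p * q)"
  shows "P p"
proof -
  have 0: "P 0" and 1: "P 1"
    using C [of 0] C [of 1] by simp_all
  have pow: "P (Var i ^ k)" for i k
    by (induction k) (auto intro: 1 V M)
  have "P (\<Prod>i\<in>A. Var i ^ Poly_Mapping.lookup m i)" for A and m :: "'n \<Rightarrow>\<^sub>0 nat"
    by (induction A rule: infinite_finite_induct) (auto intro: 1 pow M)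
  then have "P (Poly_Mapping.single m c)" for m c
    by (subst single_eq_prod_Var) (intro C M)
  then have "P (\<Sum>m\<in>A. Poly_Mapping.single m (Poly_Mapping.lookup p m))" for A
    by (induction A rule: infinite_finite_induct) (auto intro: 0 A)
  then show ?thesis
    by (metis poly_mapping_eq_sum_single)
qed

section \<open>Ideals, divisibility and the subring of differences\<close>

lemma ring_of_type_algebra_simps [simp]:
  "carrier ring_of_type_algebra = UNIV"
  "x \<otimes>\<^bsub>ring_of_type_algebra\<^esub> y = x * y"
  "x \<oplus>\<^bsub>ring_of_type_algebra\<^esub> y = x + y"
  "\<one>\<^bsub>ring_of_type_algebra\<^esub> = 1"
  "\<zero>\<^bsub>ring_of_type_algebra\<^esub> = 0"
  by (simp_all add: ring_of_type_algebra_def)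

lemma a_inv_ring_of_type_algebra [simp]:
  fixes x :: "'a::comm_ring_1"
  shows "\<ominus>\<^bsub>ring_of_type_algebra\<^esub> x = - x"
proof -
  interpret cring "ring_of_type_algebra :: 'a ring" by (rule cring_from_type_algebra)
  show ?thesis using minus_equality [of "- x" x] by simp
qed

lemma cgenideal_ring_of_type_algebra [simp]:
  fixes a :: "'a::comm_ring_1"
  shows "x \<in> PIdl\<^bsub>ring_of_type_algebra\<^esub> a \<longleftrightarrow> a dvd x"
  by (auto simp: cgenideal_def dvd_def mult.commute)

text \<open>Modulo \<open>I\<close>, the substitution and the identity are ring homomorphisms that
  agree on constants and variables, hence everywhere.\<close>

lemma psubst_diff_in_ideal:
  assumes "ideal I mpol_ring" and gen: "\<And>i. Var i - \<phi> i \<in> I"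
  shows "p - psubst \<phi> p \<in> I"
proof -
  interpret ideal I mpol_ring by fact
  have plus: "x + y \<in> I" if "x \<in> I" "y \<in> I" for x y
    using additive_subgroup.a_closed [OF additive_subgroup_axioms that] by simp
  have times: "y * x \<in> I" if "x \<in> I" for x y
    using I_l_closed [of x y] that by simp
  show ?thesis
  proof (induction p rule: mpol_induct)
    case (Const c)
    then show ?case using additive_subgroup.zero_closed [OF additive_subgroup_axioms] by simp
  next
    case (Var i)
    then show ?case using gen by simp
  next
    case (add p q)
    then show ?case using assms plus [OF add] by (simp add: algebra_simps)
  next
    case (mult p q)
    have "p * q - psubst \<phi> (p * q) = q * (p - psubst \<phi> p) + psubst \<phi> p * (q - psubst \<phi> q)"
      by (simp add: algebra_simps)
    then show ?case using mult
      by (simp add: plus times)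
  qed
qed

text \<open>The kernel of the substitution is the principal ideal of \<open>d\<close>: it contains
  \<open>d\<close>, and every \<open>p\<close> is congruent to \<open>psubst \<phi> p\<close> modulo
  \<open>d\<close>.\<close>

lemma dvd_iff_psubst_eq_0:
  assumes "\<And>i. d dvd Var i - \<phi> i" and d: "psubst \<phi> d = 0"
  shows "d dvd p \<longleftrightarrow> psubst \<phi> p = 0"
proof
  assume "d dvd p" then show "psubst \<phi> p = 0"
    using d by (auto elim!: dvdE)
next
  have "d dvd p - psubst \<phi> p"
    using psubst_diff_in_ideal [of "PIdl\<^bsub>mpol_ring\<^esub> d" \<phi> p] assms(1)
      cring.cgenideal_ideal [OF cring_from_type_algebra, of d] by simp
  moreover assume "psubst \<phi> p = 0"
  ultimately show "d dvd p" by simp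
qed

text \<open>The kernel of a ring homomorphism into a domain is a prime ideal; \<open>d\<close> is no
  unit because \<open>1\<close> is not sent to \<open>0\<close>.\<close>

lemma prime_elem_if_psubst:
  fixes d :: "('k::field, 'n::{finite,linorder}) mpol"
  assumes "\<And>i. d dvd Var i - \<phi> i" and "psubst \<phi> d = 0" and "d \<noteq> 0"
  shows "prime_elem d"
  using assms(3) by (auto simp: prime_elem_def dvd_iff_psubst_eq_0 [OF assms(1,2)])

text \<open>The substitution is \<open>\<tau>_u\<close>, which kills \<open>x_u\<close> and moves
  every variable by \<open>x_u\<close>.\<close>

lemma Var_dvd_iff:
  fixes p :: "('k::field, 'n::{finite,linorder}) mpol"
  shows "Var u dvd p \<longleftrightarrow> psubst (\<lambda>i. Var i - Var u) p = 0"
  by (rule dvd_iff_psubst_eq_0) auto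

text \<open>The substitution is restriction to the hyperplane \<open>x_u = x_v\<close>.\<close>

lemma Var_diff_dvd_iff:
  fixes p :: "('k::field, 'n::{finite,linorder}) mpol"
  shows "Var u - Var v dvd p \<longleftrightarrow> psubst (\<lambda>i. Var (if i = u then v else i)) p = 0"
  by (rule dvd_iff_psubst_eq_0) auto

lemma prime_elem_Var: "prime_elem (Var u :: ('k::field, 'n::{finite,linorder}) mpol)"
  by (rule prime_elem_if_psubst [of _ "\<lambda>i. Var i - Var u"]) auto

lemma prime_elem_Var_diff:
  assumes "u \<noteq> v"
  shows "prime_elem (Var u - Var v :: ('k::field, 'n::{finite,linorder}) mpol)"
  using assms by (intro prime_elem_if_psubst [of _ "\<lambda>i. Var (if i = u then v else i)"]) auto

lemma Var_dvd_Var_iff [simp]: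
  "Var u dvd (Var v :: ('k::field, 'n::{finite,linorder}) mpol) \<longleftrightarrow> u = v"
  by (auto simp: Var_dvd_iff)

lemma Var_diff_dvd_Var_diff_iff:
  fixes a b u v :: "'n::{finite,linorder}"
  assumes "a \<noteq> b"
  shows "Var u - Var v dvd (Var a - Var b :: ('k::field, 'n) mpol) \<longleftrightarrow> {u, v} = {a, b}"
  using assms by (auto simp: Var_diff_dvd_iff doubleton_eq_iff)

text \<open>Induction splits one prime off, \<open>p = d a * q\<close>. Any other \<open>d b\<close>
  divides this product but not \<open>d a\<close>, so it divides the cofactor
  \<open>q\<close>.\<close>

lemma prod_primes_dvd:
  fixes d :: "'a \<Rightarrow> 'b::idom"
  assumes "finite A" and "\<And>a. a \<in> A \<Longrightarrow> prime_elem (d a)" and "\<And>a. a \<in> A \<Longrightarrow> d a dvd p"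
    and "\<And>a b. a \<in> A \<Longrightarrow> b \<in> A \<Longrightarrow> a \<noteq> b \<Longrightarrow> \<not> d a dvd d b"
  shows "prod d A dvd p"
  using assms
proof (induction A arbitrary: p)
  case (insert a A)
  from insert.prems(2) [of a] obtain q where q: "p = d a * q"
    by (auto elim: dvdE)
  have "d b dvd q" if "b \<in> A" for b
    using insert.prems(1) [of b] insert.prems(2) [of b] insert.prems(3) [of b a] that insert.hyps q
      by (auto simp: prime_elem_dvd_mult_iff)
  then have "prod d A dvd q"
    by (intro insert.IH insert.prems) auto
  then show ?case
    using insert.hyps q by simp
qed simp

lemma prime_elem_dvd_prod_iff:
  fixes p :: "'b::idom"
  assumes "prime_elem p" "finite A"
  shows "p dvd prod d A \<longleftrightarrow> (\<exists>a\<in>A. p dvd d a)"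
  using assms(2)
  by (induction) (use assms(1) in \<open>auto simp: prime_elem_dvd_mult_iff prime_elem_not_unit\<close>)

text \<open>Modulo the ideal every polynomial is congruent to its image under the substitution;
  conversely, the kernel is an ideal that contains the generators.\<close>

lemma in_genideal_Var_iff:
  fixes p :: "('k::field, 'n::{finite,linorder}) mpol"
  shows "p \<in> Idl\<^bsub>mpol_ring\<^esub> (Var ` e) \<longleftrightarrow> psubst (\<lambda>i. if i \<in> e then 0 else Var i) p = 0"
    (is "_ \<longleftrightarrow> psubst ?\<phi> p = 0")
proof
  interpret cring "mpol_ring :: ('k, 'n) mpol ring" by (rule cring_from_type_algebra)
  have id: "ideal (Idl\<^bsub>mpol_ring\<^esub> (Var ` e :: ('k, 'n) mpol set)) mpol_ring"
    by (rule genideal_ideal) simp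
  have "Var i - ?\<phi> i \<in> Idl\<^bsub>mpol_ring\<^esub> (Var ` e)" for i
  proof (cases "i \<in> e")
    case True
    then show ?thesis using genideal_self [of "Var ` e"] by auto
  next
    case False
    then show ?thesis
      using additive_subgroup.zero_closed [OF ideal.axioms(1) [OF id]] by simp
  qed
  then have diff: "p - psubst ?\<phi> p \<in> Idl\<^bsub>mpol_ring\<^esub> (Var ` e)"
    by (intro psubst_diff_in_ideal id)
  {
    assume "psubst ?\<phi> p = 0"
    then show "p \<in> Idl\<^bsub>mpol_ring\<^esub> (Var ` e)" using diff by simp
  }
  have "ideal {p. psubst ?\<phi> p = 0} mpol_ring"
  proof (rule idealI)
    show "subgroup {p. psubst ?\<phi> p = 0} (add_monoid mpol_ring)"
      \<comment> \<open>The witness \<open>0\<close> shows that the kernel is inhabited; flipping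
        \<open>a_inv_def\<close> turns the inverse of the additive group into ring negation.\<close>
      by (rule add.subgroupI) (auto intro: exI [of _ 0] simp flip: a_inv_def)
  qed (auto intro: ring_from_type_algebra)
  then have "Idl\<^bsub>mpol_ring\<^esub> (Var ` e) \<subseteq> {p. psubst ?\<phi> p = 0}"
    by (intro genideal_minimal) auto
  then show "p \<in> Idl\<^bsub>mpol_ring\<^esub> (Var ` e) \<Longrightarrow> psubst ?\<phi> p = 0"
    by auto
qed

section \<open>The ring of differences as the fixed ring of a shift\<close>

lemma
  fixes p q :: "('k::field, 'n::{finite,linorder}) mpol"
  shows Const_in_diff_ring: "Const c \<in> carrier (diff_ring :: ('k, 'n) mpol ring)"
    and add_in_diff_ring: "p \<in> carrier diff_ring \<Longrightarrow> q \<in> carrier diff_ring \<Longrightarrow> p + q \<in> carrier diff_ring"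
    and mult_in_diff_ring: "p \<in> carrier diff_ring \<Longrightarrow> q \<in> carrier diff_ring \<Longrightarrow> p * q \<in> carrier diff_ring"
    and uminus_in_diff_ring: "p \<in> carrier diff_ring \<Longrightarrow> - p \<in> carrier diff_ring"
  using generate_ring.incl [of "Const c" "range Const \<union> {Var i - Var j | i j. i < j}" mpol_ring]
    generate_ring.eng_add [where R = mpol_ring] generate_ring.eng_mult [where R = mpol_ring]
    generate_ring.a_inv [where R = mpol_ring]
  by (auto simp: diff_ring_def)

lemma Var_diff_in_diff_ring:
  "Var u - Var v \<in> carrier (diff_ring :: ('k::field, 'n::{finite,linorder}) mpol ring)"
proof -
  have *: "Var u - Var v \<in> carrier (diff_ring :: ('k, 'n) mpol ring)" if "u < v" for u v :: 'n
    using that by (auto simp: diff_ring_def intro!: generate_ring.incl)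
  consider "u < v" | "u = v" | "v < u" by fastforce
  then show ?thesis
  proof cases
    case 2
    then show ?thesis using Const_in_diff_ring [of 0] by simp
  next
    case 3
    then show ?thesis using uminus_in_diff_ring [OF * [of v u]] by simp
  qed (rule *)
qed

lemma diff_ring_simps [simp]:
  "x \<otimes>\<^bsub>diff_ring\<^esub> y = x * y" "x \<oplus>\<^bsub>diff_ring\<^esub> y = x + y" "\<one>\<^bsub>diff_ring\<^esub> = 1"
  by (simp_all add: diff_ring_def)

lemma cring_diff_ring: "cring (diff_ring :: ('k::field, 'n::{finite,linorder}) mpol ring)"
proof -
  interpret cring "mpol_ring :: ('k, 'n) mpol ring" by (rule cring_from_type_algebra)
  have "subring (carrier diff_ring) (mpol_ring :: ('k, 'n) mpol ring)"
    unfolding diff_ring_def by (simp add: generate_ring_is_subring)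
  then show ?thesis
    using subcring_iff [of "carrier diff_ring"] subcringI'
    by (simp add: diff_ring_def)
qed

text \<open>For every choice of \<open>u\<close>, \<open>\<tau>_u\<close> is a retraction of
  \<open>S\<close> onto \<open>R\<close>: it sends variables to differences, and it fixes
  \<open>x_i - x_j\<close> because the two shifts cancel.\<close>

lemma in_diff_ring_iff:
  fixes p :: "('k::field, 'n::{finite,linorder}) mpol"
  shows "p \<in> carrier diff_ring \<longleftrightarrow> psubst (\<lambda>i. Var i - Var u) p = p"
proof
  assume "p \<in> carrier diff_ring"
  then have "p \<in> generate_ring mpol_ring (range Const \<union> {Var i - Var j | i j. i < j})"
    by (simp add: diff_ring_def)
  then show "psubst (\<lambda>i. Var i - Var u) p = p"
    by induction auto
next
  have "psubst (\<lambda>i. Var i - Var u) p \<in> carrier diff_ring"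
    by (induction p rule: mpol_induct)
      (auto intro: Const_in_diff_ring add_in_diff_ring mult_in_diff_ring Var_diff_in_diff_ring)
  then show "psubst (\<lambda>i. Var i - Var u) p = p \<Longrightarrow> p \<in> carrier diff_ring"
    by simp
qed

section \<open>Quotient modules\<close>

text \<open>The module axioms are equations, and the additive inverse of \<open>h a\<close> is the
  image of that of \<open>a\<close>; so all of them pass to the image. Applied to the projection
  onto cosets.\<close>

lemma module_surj_image:
  fixes M :: "('a, 'b, 'm) module_scheme" and N :: "('a, 'c, 'n) module_scheme"
  assumes "Module.module R M" and carrier: "carrier N = h ` carrier M"
    and hom_add: "\<And>x y. x \<in> carrier M \<Longrightarrow> y \<in> carrier M \<Longrightarrow> h (x \<oplus>\<^bsub>M\<^esub> y) = h x \<oplus>\<^bsub>N\<^esub> h y"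
    and hom_smult: "\<And>r x. r \<in> carrier R \<Longrightarrow> x \<in> carrier M \<Longrightarrow> h (r \<odot>\<^bsub>M\<^esub> x) = r \<odot>\<^bsub>N\<^esub> h x"
    and hom_zero: "h \<zero>\<^bsub>M\<^esub> = \<zero>\<^bsub>N\<^esub>"
  shows "Module.module R N"
proof -
  interpret Module.module R M by fact
  note hom = hom_add [symmetric] hom_smult [symmetric] hom_zero [symmetric]
  show ?thesis
  proof (rule moduleI)
    show "abelian_group N"
    proof (rule abelian_groupI)
      fix x assume "x \<in> carrier N"
      then obtain a where a: "a \<in> carrier M" "x = h a"
        by (auto simp: carrier)
      then show "\<exists>y\<in>carrier N. y \<oplus>\<^bsub>N\<^esub> x = \<zero>\<^bsub>N\<^esub>"
        by (intro bexI [of _ "h (\<ominus>\<^bsub>M\<^esub> a)"]) (auto simp: carrier hom M.l_neg)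
    qed (auto simp: carrier hom M.a_ac)
  qed (auto simp: carrier hom R.cring_axioms smult_l_distr smult_r_distr smult_assoc1)
qed

context Module.module
begin

lemma submodule_imp_abelian_subgroup:
  assumes "submodule N R M"
  shows "abelian_subgroup N M"
  using assms M.abelian_group_axioms
  by (intro abelian_subgroupI3) (auto simp: submodule_def additive_subgroup_def)

lemma quot_module_simps:
  shows "carrier (quot_module M N) = (\<lambda>x. N +>\<^bsub>M\<^esub> x) ` carrier M"
    and "\<zero>\<^bsub>quot_module M N\<^esub> = N"
  by (auto simp: quot_module_def A_RCOSETS_def')

lemma quot_module_add:
  assumes "submodule N R M" "x \<in> carrier M" "y \<in> carrier M"
  shows "(N +>\<^bsub>M\<^esub> x) \<oplus>\<^bsub>quot_module M N\<^esub> (N +>\<^bsub>M\<^esub> y) = N +>\<^bsub>M\<^esub> (x \<oplus>\<^bsub>M\<^esub> y)"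
proof -
  interpret N: abelian_subgroup N M
    by (rule submodule_imp_abelian_subgroup) fact
  show ?thesis
    using assms(2,3) N.a_rcos_sum by (simp add: quot_module_def)
qed

text \<open>The product of a scalar and a coset is a union over representatives, so all the cosets
  in that union must coincide: representatives differ by some \<open>n \<in> N\<close>, and
  \<open>N\<close> is closed under scalars.\<close>

lemma quot_module_smult:
  assumes "submodule N R M" "r \<in> carrier R" "x \<in> carrier M"
  shows "r \<odot>\<^bsub>quot_module M N\<^esub> (N +>\<^bsub>M\<^esub> x) = N +>\<^bsub>M\<^esub> (r \<odot>\<^bsub>M\<^esub> x)"
proof -
  interpret N: abelian_subgroup N M
    by (rule submodule_imp_abelian_subgroup) fact
  have "N +>\<^bsub>M\<^esub> (r \<odot>\<^bsub>M\<^esub> y) = N +>\<^bsub>M\<^esub> (r \<odot>\<^bsub>M\<^esub> x)" if "y \<in> N +>\<^bsub>M\<^esub> x" for y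
  proof -
    from that obtain n where n: "n \<in> N" "y = n \<oplus>\<^bsub>M\<^esub> x"
      by (auto simp: a_r_coset_def')
    then have "r \<odot>\<^bsub>M\<^esub> y = (r \<odot>\<^bsub>M\<^esub> n) \<oplus>\<^bsub>M\<^esub> (r \<odot>\<^bsub>M\<^esub> x)"
      using assms N.a_subset by (auto intro: smult_r_distr)
    moreover have "r \<odot>\<^bsub>M\<^esub> n \<in> N"
      using submoduleE(4) [OF assms(1,2) n(1)] .
    ultimately have "r \<odot>\<^bsub>M\<^esub> y \<in> N +>\<^bsub>M\<^esub> (r \<odot>\<^bsub>M\<^esub> x)"
      by (auto simp: a_r_coset_def')
    then show ?thesis
      using N.a_repr_independence' assms by simp
  qed
  \<comment> \<open>A union of equal cosets is that coset only over a nonempty index set.\<close>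
  moreover have "x \<in> N +>\<^bsub>M\<^esub> x"
    using N.a_rcos_self assms by simp
  ultimately have "(\<Union>y\<in>N +>\<^bsub>M\<^esub> x. N +>\<^bsub>M\<^esub> (r \<odot>\<^bsub>M\<^esub> y)) = N +>\<^bsub>M\<^esub> (r \<odot>\<^bsub>M\<^esub> x)"
    by (intro UN_constant_eq) blast+
  then show ?thesis
    by (simp add: quot_module_def)
qed

lemma quot_module_is_module:
  assumes "submodule N R M"
  shows "Module.module R (quot_module M N)"
proof (rule module_surj_image [OF module_axioms quot_module_simps(1)])
  interpret N: abelian_subgroup N M
    by (rule submodule_imp_abelian_subgroup) fact
  show "N +>\<^bsub>M\<^esub> \<zero>\<^bsub>M\<^esub> = \<zero>\<^bsub>quot_module M N\<^esub>"
    using N.a_rcos_const [OF N.zero_closed] by (simp add: quot_module_simps)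
qed (simp_all add: quot_module_add quot_module_smult assms)

end

section \<open>Logarithmic forms of graphic arrangements\<close>

lemma linear_form_axis_diff: "linear_form (axis u 1 - axis v 1) = Var u - Var v"
proof -
  have "Const ((axis u 1 - axis v 1) $ i) * Var i = (if i = u then Var u else 0) - (if i = v then Var v else 0)" for i
    by (simp add: axis_def Const_uminus)
  then have "linear_form (axis u 1 - axis v 1) =
      (\<Sum>i\<in>UNIV. (if i = u then Var u else 0) - (if i = v then Var v else 0))"
    unfolding linear_form_def by (intro sum.cong refl)
  then show ?thesis
    by (simp add: sum_subtractf)
qed

text \<open>Scaling by \<open>Q\<close> clears the denominators of the wedge product. Dividing by
  \<open>a\<close> keeps the matrix alternating, so the only condition left is that its entries are
  polynomials.\<close>

lemma scale2_wedge_in_Omega2_iff: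
  fixes f :: "'n::{finite,linorder} \<Rightarrow> ('k::field, 'n) mpol"
  assumes "Q \<noteq> 0" "a \<noteq> 0"
  shows "scale2 (to_fract Q) (wedge (\<chi> i. to_fract (f i) / to_fract Q) (diff_form c))
      \<in> scale2 (to_fract a) ` Omega2_V
    \<longleftrightarrow> (\<forall>i j. a dvd f i * Const (c $ j) - f j * Const (c $ i))"
proof -
  define g where "g i j = f i * Const (c $ j) - f j * Const (c $ i)" for i j
  have lhs: "scale2 (to_fract Q) (wedge (\<chi> i. to_fract (f i) / to_fract Q) (diff_form c))
      = (\<chi> i j. to_fract (g i j))"
    using assms by (simp add: scale2_def wedge_def diff_form_def g_def vec_eq_iff right_diff_distrib)
  have "(\<chi> i j. to_fract (g i j)) \<in> scale2 (to_fract a) ` Omega2_V \<longleftrightarrow> (\<forall>i j. a dvd g i j)"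
  proof
    assume "(\<chi> i j. to_fract (g i j)) \<in> scale2 (to_fract a) ` Omega2_V"
    then obtain \<theta> where \<theta>: "\<theta> \<in> Omega2_V" "(\<chi> i j. to_fract (g i j)) = scale2 (to_fract a) \<theta>"
      by blast
    have "a dvd g i j" for i j
    proof -
      obtain t where "\<theta> $ i $ j = to_fract t"
        using \<theta>(1) unfolding Omega2_V_def by blast
      then have "to_fract (g i j) = to_fract (a * t)"
        using arg_cong [OF \<theta>(2), of "\<lambda>x. x $ i $ j"] by (simp add: scale2_def)
      then show ?thesis
        by (simp only: to_fract_eq_iff) simp
    qed
    then show "\<forall>i j. a dvd g i j" by blast
  next
    assume dvd: "\<forall>i j. a dvd g i j"
    have "\<forall>i j. to_fract (g i j) / to_fract a \<in> range to_fract"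
    proof (intro allI)
      fix i j
      from dvd obtain t where "g i j = a * t" by (meson dvdE)
      then show "to_fract (g i j) / to_fract a \<in> range to_fract" using assms by simp
    qed
    moreover have "\<forall>i j. to_fract (g j i) / to_fract a = - (to_fract (g i j) / to_fract a)"
      by (simp add: g_def minus_divide_left)
    moreover have "\<forall>i. to_fract (g i i) / to_fract a = 0"
      by (simp add: g_def)
    ultimately have "(\<chi> i j. to_fract (g i j) / to_fract a) \<in> Omega2_V"
      unfolding Omega2_V_def mem_Collect_eq vec_lambda_beta by blast
    moreover have "(\<chi> i j. to_fract (g i j)) = scale2 (to_fract a) (\<chi> i j. to_fract (g i j) / to_fract a)"
      using assms by (simp add: scale2_def vec_eq_iff)
    ultimately show "(\<chi> i j. to_fract (g i j)) \<in> scale2 (to_fract a) ` Omega2_V"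
      by blast
  qed
  then show ?thesis
    by (simp add: lhs g_def)
qed

text \<open>The numerators over \<open>Q\<close> of the coefficients of the forms in \<open>log_forms_R\<close>.\<close>

definition log_coeffs :: "'n set set \<Rightarrow> ('n::{finite,linorder} \<Rightarrow> ('k::field, 'n) mpol) set"
  where "log_coeffs E = {f. (\<forall>i. f i \<in> carrier diff_ring) \<and>
    (\<forall>u v. {u, v} \<in> E \<longrightarrow>
      (\<forall>i. i \<noteq> u \<longrightarrow> i \<noteq> v \<longrightarrow> Var u - Var v dvd f i) \<and> Var u - Var v dvd f u + f v)}"

text \<open>Only the entries of \<open>c\<close> at \<open>u\<close> and \<open>v\<close> are
  nonzero. A pair formed by \<open>i\<close> outside the edge and one of its ends yields
  \<open>f i\<close> up to sign, the pair \<open>(u, v)\<close> yields \<open>- (f u + f v)\<close>,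
  and pairs outside the edge yield \<open>0\<close>.\<close>

lemma edge_condition_iff:
  fixes f :: "'n::{finite,linorder} \<Rightarrow> ('k::field, 'n) mpol"
  assumes "u \<noteq> v" and c: "c = axis u 1 - axis v 1"
  shows "(\<forall>i j. d dvd f i * Const (c $ j) - f j * Const (c $ i)) \<longleftrightarrow>
    (\<forall>i. i \<noteq> u \<longrightarrow> i \<noteq> v \<longrightarrow> d dvd f i) \<and> d dvd f u + f v"
proof -
  have c_nth: "Const (c $ i) = (if i = u then 1 else if i = v then - 1 else (0 :: ('k, 'n) mpol))" for i
    using assms by (auto simp: axis_def Const_uminus)
  show ?thesis
  proof safe
    fix i assume *: "\<forall>i j. d dvd f i * Const (c $ j) - f j * Const (c $ i)" "i \<noteq> u" "i \<noteq> v"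
    then show "d dvd f i"
      using spec [OF spec [OF *(1)], of i u] by (simp add: c_nth)
  next
    assume *: "\<forall>i j. d dvd f i * Const (c $ j) - f j * Const (c $ i)"
    have "d dvd - (f u + f v)"
      using spec [OF spec [OF *(1)], of u v] assms(1) by (simp add: c_nth)
    then show "d dvd f u + f v" by (simp only: dvd_minus_iff)
  next
    fix i j assume *: "\<forall>i. i \<noteq> u \<longrightarrow> i \<noteq> v \<longrightarrow> d dvd f i" "d dvd f u + f v"
    have "d dvd - (f u + f v)" using *(2) by (simp only: dvd_minus_iff)
    then show "d dvd f i * Const (c $ j) - f j * Const (c $ i)"
      using * by (auto simp: c_nth add.commute)
  qed
qed

section \<open>Graphic arrangements and their defining polynomial\<close>

locale graphic =
  fixes E :: "'n::{finite,linorder} set set"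
    and \<alpha> :: "('k::field, 'n) vect set \<Rightarrow> ('k, 'n) vect"
  assumes simple: "simple_graph E" and forms: "graphic_forms E \<alpha>"
begin

abbreviation "arr \<equiv> graphic_arrangement E :: ('k, 'n) vect set set"

abbreviation "Q \<equiv> defining_poly arr \<alpha>"

lemma edge_neq: "{u, v} \<in> E \<Longrightarrow> u \<noteq> v"
  using simple by (auto simp: simple_graph_def)

text \<open>The hyperplane is symmetric in its two vertices, so they can be named such that the
  chosen form has the sign of \<open>x_u - x_v\<close>.\<close>

lemma arr_cases:
  assumes "H \<in> arr"
  obtains u v where "H = diag_hyperplane u v" "{u, v} \<in> E" "u \<noteq> v" "\<alpha> H = axis u 1 - axis v 1"
    "linear_form (\<alpha> H) = Var u - Var v"
proof -
  from assms obtain u v where *: "H = diag_hyperplane u v" "{u, v} \<in> E"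
    by (auto simp: graphic_arrangement_def)
  then have "\<alpha> H = axis u 1 - axis v 1 \<or> \<alpha> H = axis v 1 - axis u 1"
    using forms by (auto simp: graphic_forms_def)
  moreover have "H = diag_hyperplane v u" "{v, u} \<in> E" "u \<noteq> v" "v \<noteq> u"
    using * edge_neq [of u v] by (auto simp: diag_hyperplane_def insert_commute)
  ultimately show ?thesis
    using that [of u v] that [of v u] * by (auto simp: linear_form_axis_diff)
qed

lemma finite_arr [simp]: "finite arr"
  by (rule finite_subset [of _ "(\<lambda>(u, v). diag_hyperplane u v) ` UNIV"])
    (auto simp: graphic_arrangement_def)

lemma edge_arr_cases:
  assumes "{u, v} \<in> E"
  obtains H where "H \<in> arr" "linear_form (\<alpha> H) = Var u - Var v \<or> linear_form (\<alpha> H) = - (Var u - Var v)"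
proof -
  have "\<alpha> (diag_hyperplane u v) = axis u 1 - axis v 1 \<or> \<alpha> (diag_hyperplane u v) = axis v 1 - axis u 1"
    using forms assms by (auto simp: graphic_forms_def)
  then show ?thesis
    using assms by (intro that [of "diag_hyperplane u v"])
      (auto simp: graphic_arrangement_def linear_form_axis_diff)
qed

lemma edge_dvd_Q:
  assumes "{u, v} \<in> E"
  shows "Var u - Var v dvd Q"
proof -
  from edge_arr_cases [OF assms] obtain H where H: "H \<in> arr"
    "linear_form (\<alpha> H) = Var u - Var v \<or> linear_form (\<alpha> H) = - (Var u - Var v)" .
  have "linear_form (\<alpha> H) dvd Q"
    unfolding defining_poly_def using H(1) by (intro dvd_prodI) auto
  then show ?thesis
    using H(2) minus_dvd_iff [of "Var u - Var v" Q] by metis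
qed

text \<open>The defining forms are pairwise non-associated primes: divisibility between two of them
  forces equal vertex pairs, hence equal hyperplanes.\<close>

lemma Q_dvdI:
  assumes "\<And>u v. {u, v} \<in> E \<Longrightarrow> Var u - Var v dvd p"
  shows "Q dvd p"
  unfolding defining_poly_def
proof (rule prod_primes_dvd)
  fix H assume "H \<in> arr"
  then show "prime_elem (linear_form (\<alpha> H))" "linear_form (\<alpha> H) dvd p"
    by (auto elim!: arr_cases simp: prime_elem_Var_diff assms)
next
  fix H H' assume "H \<in> arr" "H' \<in> arr" "H \<noteq> H'"
  then show "\<not> linear_form (\<alpha> H) dvd linear_form (\<alpha> H')"
    by (elim arr_cases) (auto simp: Var_diff_dvd_Var_diff_iff doubleton_eq_iff diag_hyperplane_def)
qed simp

lemma Q_neq_0 [simp]: "Q \<noteq> 0"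
  by (auto simp: defining_poly_def elim!: arr_cases)

text \<open>Two distinct two-element sets do not contain each other, so a non-edge contains at most
  one end of every edge and no factor of \<open>Q\<close> vanishes.\<close>

lemma psubst_Q_neq_0:
  assumes "e \<in> compl_graph E"
  shows "psubst (\<lambda>i. if i \<in> e then 0 else Var i) Q \<noteq> 0"
proof -
  have "psubst (\<lambda>i. if i \<in> e then 0 else Var i) (Var u - Var v) \<noteq> (0 :: ('k, 'n) mpol)"
    if "{u, v} \<in> E" for u v
  proof -
    have "\<not> {u, v} \<subseteq> e"
      using assms that edge_neq [OF that] card_subset_eq [of e "{u, v}"]
      by (auto simp: compl_graph_def)
    then show ?thesis
      using edge_neq [OF that] by auto
  qed
  then show ?thesis
    by (auto simp: defining_poly_def elim!: arr_cases simp del: psubst_diff)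
qed

text \<open>Passes from rational forms to polynomial numerators over \<open>Q\<close>, where being
  logarithmic is divisibility by the \<open>x_u - x_v\<close>.\<close>

lemma in_log_forms_R_iff:
  "\<omega> \<in> log_forms_R arr \<alpha> \<longleftrightarrow>
    (\<exists>f\<in>log_coeffs E. \<omega> = (\<chi> i. to_fract (f i) / to_fract Q))"
proof -
  \<comment> \<open>The set \<open>A\<close> is kept general for two uses: all of \<open>S\<close>,
    which gives \<open>Omega1_V\<close>, and the subring \<open>R\<close>.\<close>
  have R: "\<omega> \<in> (\<lambda>\<eta>. inverse (to_fract Q) *s \<eta>) ` {\<eta>. \<forall>i. \<eta> $ i \<in> to_fract ` A} \<longleftrightarrow>
      (\<exists>f. (\<forall>i. f i \<in> A) \<and> \<omega> = (\<chi> i. to_fract (f i) / to_fract Q))" (is "?L \<longleftrightarrow> ?R") for A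
  proof
    assume ?L
    then obtain \<eta> where \<eta>: "\<omega> = inverse (to_fract Q) *s \<eta>" "\<forall>i. \<exists>a\<in>A. \<eta> $ i = to_fract a"
      by blast
    from \<eta>(2) obtain f where "\<forall>i. f i \<in> A \<and> \<eta> $ i = to_fract (f i)"
      by metis
    then show ?R
      using \<eta>(1) by (intro exI [of _ f]) (simp add: vec_eq_iff divide_inverse mult.commute)
  next
    assume ?R
    then obtain f where "\<forall>i. f i \<in> A" "\<omega> = (\<chi> i. to_fract (f i) / to_fract Q)"
      by blast
    then show ?L
      by (intro image_eqI [of _ _ "\<chi> i. to_fract (f i)"])
        (auto simp: vec_eq_iff divide_inverse mult.commute)
  qed
  have wedge_iff: "(\<forall>H\<in>arr. scale2 (to_fract Q) (wedge (\<chi> i. to_fract (f i) / to_fract Q) (diff_form (\<alpha> H)))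
      \<in> scale2 (to_fract (linear_form (\<alpha> H))) ` Omega2_V) \<longleftrightarrow>
    (\<forall>u v. {u, v} \<in> E \<longrightarrow> (\<forall>i. i \<noteq> u \<longrightarrow> i \<noteq> v \<longrightarrow> Var u - Var v dvd f i) \<and> Var u - Var v dvd f u + f v)"
    (is "?L \<longleftrightarrow> ?R") for f :: "'n \<Rightarrow> ('k, 'n) mpol"
  proof
    assume L: ?L
    have *: "(\<forall>i. i \<noteq> u \<longrightarrow> i \<noteq> v \<longrightarrow> Var u - Var v dvd f i) \<and> Var u - Var v dvd f u + f v"
      if uv: "u \<noteq> v" and H: "H \<in> arr" "\<alpha> H = axis u 1 - axis v 1" for u v H
    proof -
      have "linear_form (\<alpha> H) \<noteq> 0"
        using uv H by (simp add: linear_form_axis_diff)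
      then have "\<forall>i j. linear_form (\<alpha> H) dvd f i * Const (\<alpha> H $ j) - f j * Const (\<alpha> H $ i)"
        using L H(1) scale2_wedge_in_Omega2_iff [OF Q_neq_0, of "linear_form (\<alpha> H)" f "\<alpha> H"]
        by blast
      then show ?thesis
        unfolding edge_condition_iff [OF uv H(2)] by (simp add: H(2) linear_form_axis_diff)
    qed
    show ?R
    proof (intro allI impI)
      fix u v assume uv: "{u, v} \<in> E"
      let ?H = "diag_hyperplane u v"
      have H: "?H \<in> arr" "\<alpha> ?H = axis u 1 - axis v 1 \<or> \<alpha> ?H = axis v 1 - axis u 1"
        using uv forms by (auto simp: graphic_arrangement_def graphic_forms_def)
      \<comment> \<open>The form chosen for the edge may have either sign; the conditions on
        \<open>f\<close> are the same for both.\<close>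
      have "Var v - Var u dvd p \<longleftrightarrow> Var u - Var v dvd p" for p :: "('k, 'n) mpol"
        by (metis minus_diff_eq minus_dvd_iff)
      then show "(\<forall>i. i \<noteq> u \<longrightarrow> i \<noteq> v \<longrightarrow> Var u - Var v dvd f i) \<and> Var u - Var v dvd f u + f v"
        using H * [of u v ?H] * [of v u ?H] edge_neq [OF uv] by (auto simp: add.commute)
    qed
  next
    assume R: ?R
    show ?L
    proof
      fix H assume "H \<in> arr"
      then obtain u v where uv: "{u, v} \<in> E" "u \<noteq> v" "\<alpha> H = axis u 1 - axis v 1"
        "linear_form (\<alpha> H) = Var u - Var v"
        by (rule arr_cases)
      then have "linear_form (\<alpha> H) \<noteq> 0" by simp
      then show "scale2 (to_fract Q) (wedge (\<chi> i. to_fract (f i) / to_fract Q) (diff_form (\<alpha> H)))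
          \<in> scale2 (to_fract (linear_form (\<alpha> H))) ` Omega2_V"
        unfolding scale2_wedge_in_Omega2_iff [OF Q_neq_0 \<open>linear_form (\<alpha> H) \<noteq> 0\<close>]
          edge_condition_iff [OF uv(2,3)]
        using R uv(1) unfolding uv(4) by blast
    qed
  qed
  have V: "Omega1_V = {\<eta>. \<forall>i. \<eta> $ i \<in> to_fract ` (UNIV :: ('k, 'n) mpol set)}"
    by (simp add: Omega1_V_def)
  have mem: "\<omega> \<in> log_forms_R arr \<alpha> \<longleftrightarrow>
      (\<exists>f. (\<forall>i. f i \<in> UNIV) \<and> \<omega> = (\<chi> i. to_fract (f i) / to_fract Q)) \<and>
      (\<forall>H\<in>arr. scale2 (to_fract Q) (wedge \<omega> (diff_form (\<alpha> H)))
        \<in> scale2 (to_fract (linear_form (\<alpha> H))) ` Omega2_V) \<and>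
      (\<exists>f. (\<forall>i. f i \<in> carrier diff_ring) \<and> \<omega> = (\<chi> i. to_fract (f i) / to_fract Q))"
    unfolding log_forms_R_def log_forms_def Let_def Int_iff mem_Collect_eq R V by (simp only: conj_assoc)
  show ?thesis
  proof
    assume "\<omega> \<in> log_forms_R arr \<alpha>"
    then obtain f where f: "\<forall>i. f i \<in> carrier diff_ring" "\<omega> = (\<chi> i. to_fract (f i) / to_fract Q)"
      and "\<forall>H\<in>arr. scale2 (to_fract Q) (wedge \<omega> (diff_form (\<alpha> H)))
        \<in> scale2 (to_fract (linear_form (\<alpha> H))) ` Omega2_V"
      unfolding mem by blast
    then have "f \<in> log_coeffs E"
      unfolding log_coeffs_def mem_Collect_eq using wedge_iff [of f] by simp
    then show "\<exists>f\<in>log_coeffs E. \<omega> = (\<chi> i. to_fract (f i) / to_fract Q)"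
      using f by blast
  next
    assume "\<exists>f\<in>log_coeffs E. \<omega> = (\<chi> i. to_fract (f i) / to_fract Q)"
    then obtain f where f: "f \<in> log_coeffs E" "\<omega> = (\<chi> i. to_fract (f i) / to_fract Q)"
      by blast
    have "\<forall>H\<in>arr. scale2 (to_fract Q) (wedge \<omega> (diff_form (\<alpha> H)))
        \<in> scale2 (to_fract (linear_form (\<alpha> H))) ` Omega2_V"
      unfolding f(2) wedge_iff using f(1) unfolding log_coeffs_def by blast
    then show "\<omega> \<in> log_forms_R arr \<alpha>"
      unfolding mem using f unfolding log_coeffs_def by blast
  qed
qed

end

section \<open>Shifts as interpolation nodes\<close>

lemma psubst_shift_compl_prod_Var:
  "psubst (\<lambda>j. Var j - Var u) (\<Prod>j\<in>-{i}. Var j) =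
    (if i = u then \<Prod>j\<in>-{u}. Var j - Var u else (0 :: ('k::field, 'n::{finite,linorder}) mpol))"
  by (auto intro!: prod_zero)

lemma compl_prod_Var_diff_neq_0:
  "(\<Prod>j\<in>-{u}. Var j - Var u) \<noteq> (0 :: ('k::field, 'n::{finite,linorder}) mpol)"
  by auto

text \<open>\<open>\<tau>_u\<close> and \<open>\<tau>_v\<close> agree modulo
  \<open>x_u - x_v\<close> on the generators of \<open>S\<close>, hence on all polynomials.\<close>

lemma Var_diff_dvd_psubst_shift_diff:
  fixes p :: "('k::field, 'n::{finite,linorder}) mpol"
  shows "Var u - Var v dvd psubst (\<lambda>j. Var j - Var u) p - psubst (\<lambda>j. Var j - Var v) p"
proof (induction p rule: mpol_induct)
  case (Var i)
  have "(Var i - Var u) - (Var i - Var v) = - (Var u - Var v :: ('k, 'n) mpol)" by simp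
  then show ?case by (metis dvd_minus_iff dvd_refl psubst_Var)
next
  case (add p q)
  then show ?case
    using dvd_add [OF add] by (simp add: algebra_simps)
next
  case (mult p q)
  let ?u = "psubst (\<lambda>j. Var j - Var u)" and ?v = "psubst (\<lambda>j. Var j - Var v)"
  have "?u (p * q) - ?v (p * q) = (?u p - ?v p) * ?u q + ?v p * (?u q - ?v q)"
    by (simp add: algebra_simps)
  then show ?case
    using mult by simp
qed simp

section \<open>From logarithmic forms to the cover ideal\<close>

context graphic
begin

text \<open>Checked for one edge at a time: the terms outside the edge are divisible by assumption,
  and the two terms at its ends are combined so that \<open>f u + f v\<close> appears.\<close>

lemma Q_dvd_sum:
  assumes f: "f \<in> log_coeffs E"
  shows "Q dvd (\<Sum>i\<in>UNIV. f i * (\<Prod>j\<in>-{i}. Var j))"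
proof (rule Q_dvdI)
  fix u v assume uv: "{u, v} \<in> E"
  note neq = edge_neq [OF uv]
  let ?d = "Var u - Var v :: ('k, 'n) mpol" and ?P = "\<Prod>j\<in>-{u, v}. Var j :: ('k, 'n) mpol"
  have Pu: "(\<Prod>j\<in>-{u}. Var j) = Var v * ?P"
  proof -
    have "-{u} = insert v (-{u, v})" using neq by auto
    then show ?thesis by simp
  qed
  have Pv: "(\<Prod>j\<in>-{v}. Var j) = Var u * ?P"
  proof -
    have "-{v} = insert u (-{u, v})" using neq by auto
    then show ?thesis by simp
  qed
  have "(\<Sum>i\<in>UNIV. f i * (\<Prod>j\<in>-{i}. Var j)) =
      (\<Sum>i\<in>insert u (insert v (-{u, v})). f i * (\<Prod>j\<in>-{i}. Var j))"
    by (rule sum.cong) auto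
  also have "\<dots> = f u * (Var v * ?P) + (f v * (Var u * ?P) + (\<Sum>i\<in>-{u, v}. f i * (\<Prod>j\<in>-{i}. Var j)))"
    using neq by (simp add: Pu Pv)
  \<comment> \<open>Replaces \<open>x_u\<close> by \<open>x_v + (x_u - x_v)\<close> in the term at
    \<open>v\<close>.\<close>
  also have "\<dots> = (f u + f v) * (Var v * ?P) + ?d * (f v * ?P) + (\<Sum>i\<in>-{u, v}. f i * (\<Prod>j\<in>-{i}. Var j))"
    by (simp add: algebra_simps)
  also have "?d dvd \<dots>"
  proof (intro dvd_add dvd_sum)
    show "?d dvd (f u + f v) * (Var v * ?P)"
      using f uv by (intro dvd_mult2) (auto simp: log_coeffs_def)
    show "?d dvd f i * (\<Prod>j\<in>-{i}. Var j)" if "i \<in> -{u, v}" for i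
      using f uv that by (intro dvd_mult2) (auto simp: log_coeffs_def)
  qed simp
  finally show "?d dvd (\<Sum>i\<in>UNIV. f i * (\<Prod>j\<in>-{i}. Var j))" .
qed

text \<open>Each product omits just one variable, so it retains one from every non-edge and dies
  when these are set to zero. Since \<open>Q\<close> survives, \<open>F\<close> must vanish
  there.\<close>

lemma in_cover_ideal_if_sum:
  assumes F: "Q * F = (\<Sum>i\<in>UNIV. f i * (\<Prod>j\<in>-{i}. Var j))"
  shows "F \<in> cover_ideal (compl_graph E)"
  unfolding cover_ideal_def
proof
  fix e assume e: "e \<in> compl_graph E"
  let ?\<rho> = "psubst (\<lambda>i. if i \<in> e then 0 else Var i) :: ('k, 'n) mpol \<Rightarrow> _"
  have \<rho>: "?\<rho> (\<Prod>j\<in>-{i}. Var j) = 0" for i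
  proof -
    have "\<not> e \<subseteq> {i}"
      using e card_mono [of "{i}" e] by (auto simp: compl_graph_def)
    then show ?thesis by auto
  qed
  have "?\<rho> (Q * F) = 0"
    unfolding F by (simp add: \<rho> del: psubst_prod)
  then show "F \<in> Idl\<^bsub>mpol_ring\<^esub> (Var ` e)"
    using psubst_Q_neq_0 [OF e] by (simp add: in_genideal_Var_iff)
qed

text \<open>\<open>\<tau>_u\<close> kills every term that contains \<open>x_u\<close>, leaving the
  one at \<open>u\<close>, and it fixes \<open>f u\<close> as an element of
  \<open>R\<close>.\<close>

lemma psubst_shift_sum:
  assumes F: "Q * F = (\<Sum>i\<in>UNIV. f i * (\<Prod>j\<in>-{i}. Var j))" and f: "f u \<in> carrier diff_ring"
  shows "psubst (\<lambda>j. Var j - Var u) (Q * F) = f u * (\<Prod>j\<in>-{u}. Var j - Var u)"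
proof -
  have "psubst (\<lambda>j. Var j - Var u) (Q * F) =
      (\<Sum>i\<in>UNIV. psubst (\<lambda>j. Var j - Var u) (f i) * (if i = u then \<Prod>j\<in>-{u}. Var j - Var u else 0))"
    unfolding F psubst_sum psubst_mult [of _ "f _"] psubst_shift_compl_prod_Var ..
  also have "\<dots> = psubst (\<lambda>j. Var j - Var u) (f u) * (\<Prod>j\<in>-{u}. Var j - Var u)"
    by (simp add: if_distrib [of "\<lambda>x. _ * x"] cong: if_cong)
  finally show ?thesis
    using f by (simp add: in_diff_ring_iff [of _ u])
qed

text \<open>This gives injectivity: if \<open>x_u\<close> divides \<open>F\<close>, then
  \<open>\<tau>_u\<close> annihilates it, and a nonzero product can be cancelled from the
  interpolation formula.\<close>

lemma coeffs_eq_0_if_prod_Var_dvd: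
  assumes F: "Q * F = (\<Sum>i\<in>UNIV. f i * (\<Prod>j\<in>-{i}. Var j))" and f: "f u \<in> carrier diff_ring"
    and dvd: "(\<Prod>i\<in>UNIV. Var i) dvd F"
  shows "f u = 0"
proof -
  have "Var u dvd F"
    using dvd dvd_trans [OF dvd_prodI [of UNIV u Var]] by simp
  then have "psubst (\<lambda>j. Var j - Var u) (Q * F) = 0"
    by (simp add: Var_dvd_iff)
  then show ?thesis
    using psubst_shift_sum [OF F f] compl_prod_Var_diff_neq_0 [of u] by (simp del: psubst_mult)
qed

section \<open>From the cover ideal back to logarithmic forms\<close>

lemma Q_in_diff_ring: "Q \<in> carrier diff_ring"
proof -
  have "(\<Prod>H\<in>A. linear_form (\<alpha> H)) \<in> carrier (diff_ring :: ('k, 'n) mpol ring)" if "A \<subseteq> arr" for A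
    using that
  proof (induction A rule: infinite_finite_induct)
    case (insert H A)
    then have "H \<in> arr" by simp
    then have "linear_form (\<alpha> H) \<in> carrier diff_ring"
      by (rule arr_cases) (simp add: Var_diff_in_diff_ring)
    then show ?case
      using insert by (simp add: mult_in_diff_ring)
  qed (use Const_in_diff_ring [of 1] in auto)
  then show ?thesis by (simp add: defining_poly_def)
qed

text \<open>Each factor is supplied either by \<open>Q\<close>, if \<open>{j, u}\<close> is an edge,
  or by \<open>F \<in> (x_j, x_u)\<close>, since \<open>\<tau>_u\<close> maps these two generators
  to \<open>x_j - x_u\<close> and \<open>0\<close>.\<close>

lemma compl_prod_Var_diff_dvd:
  assumes F: "F \<in> cover_ideal (compl_graph E)"
  shows "(\<Prod>j\<in>-{u}. Var j - Var u) dvd Q * psubst (\<lambda>j. Var j - Var u) F"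
proof (rule prod_primes_dvd)
  fix j assume j: "j \<in> -{u}"
  then show "prime_elem (Var j - Var u :: ('k, 'n) mpol)"
    by (auto intro: prime_elem_Var_diff)
  show "Var j - Var u dvd Q * psubst (\<lambda>j. Var j - Var u) F"
  proof (cases "{j, u} \<in> E")
    case True
    then show ?thesis by (intro dvd_mult2 edge_dvd_Q)
  next
    case False
    \<comment> \<open>The preimage of the ideal of \<open>x_j - x_u\<close> under
      \<open>\<tau>_u\<close>.\<close>
    let ?I = "{p. Var j - Var u dvd psubst (\<lambda>j. Var j - Var u) p} :: ('k, 'n) mpol set"
    interpret cring "mpol_ring :: ('k, 'n) mpol ring" by (rule cring_from_type_algebra)
    have "ideal ?I mpol_ring"
    proof (rule idealI)
      show "subgroup ?I (add_monoid mpol_ring)"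
        by (rule add.subgroupI) (auto intro: exI [of _ 0] simp flip: a_inv_def)
    qed (auto intro: ring_from_type_algebra)
    then have "Idl\<^bsub>mpol_ring\<^esub> (Var ` {j, u}) \<subseteq> ?I"
      by (intro genideal_minimal) auto
    moreover have "{j, u} \<in> compl_graph E"
      using False j by (simp add: compl_graph_def)
    moreover from this have "F \<in> Idl\<^bsub>mpol_ring\<^esub> (Var ` {j, u})"
      using F unfolding cover_ideal_def by blast
    ultimately have "F \<in> ?I"
      by blast
    then show ?thesis by (simp add: dvd_mult)
  qed
next
  fix i j assume "i \<in> -{u}" "j \<in> -{u}" "i \<noteq> j"
  then show "\<not> Var i - Var u dvd (Var j - Var u :: ('k, 'n) mpol)"
    by (auto simp: Var_diff_dvd_Var_diff_iff doubleton_eq_iff)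
qed simp

text \<open>Interpolation determines \<open>f u\<close> as a quotient. The work lies in showing that
  it is in \<open>R\<close> and that \<open>Q\<close> contributes the factors demanded at the
  edges.\<close>

lemma ex_log_coeffs:
  assumes F: "F \<in> cover_ideal (compl_graph E)"
  obtains f where "f \<in> log_coeffs E"
    "\<And>u. f u * (\<Prod>j\<in>-{u}. Var j - Var u) = Q * psubst (\<lambda>j. Var j - Var u) F"
proof -
  have "\<forall>u. \<exists>g. Q * psubst (\<lambda>j. Var j - Var u) F = (\<Prod>j\<in>-{u}. Var j - Var u) * g"
    using compl_prod_Var_diff_dvd [OF F] by (auto simp: dvd_def)
  then obtain f where f: "\<And>u. Q * psubst (\<lambda>j. Var j - Var u) F = (\<Prod>j\<in>-{u}. Var j - Var u) * f u"
    by metis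
  have R: "f u \<in> carrier diff_ring" for u
  proof -
    let ?\<tau> = "psubst (\<lambda>j. Var j - Var u) :: ('k, 'n) mpol \<Rightarrow> _"
    \<comment> \<open>\<open>\<tau>_u\<close> sends \<open>x_u\<close> to \<open>0\<close>, so
      shifting a second time changes nothing. Applying it to the equation for \<open>f u\<close> can
      thus affect \<open>f u\<close> alone.\<close>
    have idem: "?\<tau> (?\<tau> p) = ?\<tau> p" for p
      by (induction p rule: mpol_induct) auto
    have "?\<tau> Q = Q"
      using Q_in_diff_ring by (simp add: in_diff_ring_iff [of _ u])
    moreover have "?\<tau> (Q * ?\<tau> F) = ?\<tau> ((\<Prod>j\<in>-{u}. Var j - Var u) * f u)"
      by (simp only: f)
    ultimately have "Q * ?\<tau> F = (\<Prod>j\<in>-{u}. Var j - Var u) * ?\<tau> (f u)"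
      by (simp add: idem)
    then show ?thesis
      using compl_prod_Var_diff_neq_0 [of u] unfolding f by (simp add: in_diff_ring_iff [of _ u])
  qed
  have not_dvd: "\<not> Var u - Var v dvd (\<Prod>j\<in>A. Var j - Var i :: ('k, 'n) mpol)"
    if "u \<noteq> v" "\<And>j. j \<in> A \<Longrightarrow> j \<noteq> i \<and> {j, i} \<noteq> {u, v}" for u v i A
  proof -
    have "\<not> Var u - Var v dvd (Var j - Var i :: ('k, 'n) mpol)" if "j \<in> A" for j
      using Var_diff_dvd_Var_diff_iff [of j i u v] that \<open>\<And>j. j \<in> A \<Longrightarrow> j \<noteq> i \<and> {j, i} \<noteq> {u, v}\<close> [of j]
      by metis
    then show ?thesis
      using prime_elem_dvd_prod_iff [OF prime_elem_Var_diff [OF \<open>u \<noteq> v\<close>], of A "\<lambda>j. Var j - Var i :: ('k, 'n) mpol"]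
      by simp
  qed
  have "f \<in> log_coeffs E"
    unfolding log_coeffs_def
  proof (intro CollectI conjI allI impI R)
    fix u v i assume uv: "{u, v} \<in> E" and i: "i \<noteq> u" "i \<noteq> v"
    note prime = prime_elem_Var_diff [OF edge_neq [OF uv]]
    have "Var u - Var v dvd (\<Prod>j\<in>-{i}. Var j - Var i) * f i"
      unfolding f [symmetric] using uv by (intro dvd_mult2 edge_dvd_Q)
    \<comment> \<open>All factors involve the third vertex \<open>i\<close>, so the prime coming
      from \<open>Q\<close> must divide \<open>f i\<close>.\<close>
    moreover have "\<not> Var u - Var v dvd (\<Prod>j\<in>-{i}. Var j - Var i :: ('k, 'n) mpol)"
      using i edge_neq [OF uv] by (intro not_dvd) (auto simp: doubleton_eq_iff)
    ultimately show "Var u - Var v dvd f i"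
      by (simp add: prime_elem_dvd_mult_iff [OF prime])
  next
    fix u v assume uv: "{u, v} \<in> E"
    note neq = edge_neq [OF uv]
    let ?d = "Var u - Var v :: ('k, 'n) mpol"
    let ?D = "\<lambda>w. \<Prod>j\<in>-{u, v}. Var j - Var w :: ('k, 'n) mpol"
    let ?\<tau> = "\<lambda>w. psubst (\<lambda>j. Var j - Var w) :: ('k, 'n) mpol \<Rightarrow> _"
    \<comment> \<open>The prime \<open>x_u - x_v\<close> is removed from \<open>Q\<close> and from
      both interpolation products. It occurs there with opposite signs, which is why the sum of
      \<open>f u\<close> and \<open>f v\<close> is the divisible one.\<close>
    obtain Q' where Q': "Q = ?d * Q'"
      using edge_dvd_Q [OF uv] by (auto elim: dvdE)
    have Du: "(\<Prod>j\<in>-{u}. Var j - Var u) = - ?d * ?D u"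
    proof -
      have "-{u} = insert v (-{u, v})" using neq by auto
      then show ?thesis by simp
    qed
    have "?d * (?D u * f u) = ?d * (- (Q' * ?\<tau> u F))"
      using f [of u] unfolding Du Q' by (simp add: algebra_simps)
    then have fu: "?D u * f u = - (Q' * ?\<tau> u F)"
      using neq by (subst (asm) mult_cancel_left) simp
    have Dv: "(\<Prod>j\<in>-{v}. Var j - Var v) = ?d * ?D v"
    proof -
      have "-{v} = insert u (-{u, v})" using neq by auto
      then show ?thesis by simp
    qed
    have "?d * (?D v * f v) = ?d * (Q' * ?\<tau> v F)"
      using f [of v] unfolding Dv Q' by (simp add: algebra_simps)
    then have fv: "?D v * f v = Q' * ?\<tau> v F"
      using neq by (subst (asm) mult_cancel_left) simp
    have "?D u * ?D v * (f u + f v) = ?D v * (?D u * f u) + ?D u * (?D v * f v)"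
      by (simp add: algebra_simps)
    \<comment> \<open>Adding and subtracting \<open>?D v * ?\<tau> v F\<close> leaves only
      differences between values at \<open>u\<close> and at \<open>v\<close>.\<close>
    also have "\<dots> = Q' * ((?D u - ?D v) * ?\<tau> v F - ?D v * (?\<tau> u F - ?\<tau> v F))"
      unfolding fu fv by (simp add: algebra_simps)
    also have "?d dvd \<dots>"
    proof -
      \<comment> \<open>\<open>?D w\<close> is the image of a single monomial under
        \<open>\<tau>_w\<close>, so the congruence of the two shifts applies to it as well.\<close>
      have "?d dvd ?D u - ?D v"
        using Var_diff_dvd_psubst_shift_diff [of u v "\<Prod>j\<in>-{u, v}. Var j"] by simp
      then show ?thesis
        by (intro dvd_mult [OF dvd_diff [OF dvd_mult2 dvd_mult [OF Var_diff_dvd_psubst_shift_diff]]])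
    qed
    finally have "?d dvd ?D u * ?D v * (f u + f v)" .
    \<comment> \<open>Each factor of \<open>?D w\<close> joins one end of the edge to a third
      vertex.\<close>
    moreover have "\<not> ?d dvd ?D w" if "w = u \<or> w = v" for w
      using neq that by (intro not_dvd) (auto simp: doubleton_eq_iff)
    ultimately show "?d dvd f u + f v"
      by (simp add: prime_elem_dvd_mult_iff [OF prime_elem_Var_diff [OF neq]])
  qed
  then show ?thesis
    using that f by (simp add: mult.commute)
qed

text \<open>\<open>F\<close> and the interpolant \<open>F'\<close> have the same image under every
  \<open>\<tau>_u\<close>, so each \<open>x_u\<close> divides their difference; these are distinct
  primes, so their product does too.\<close>

lemma ex_log_coeffs_cong:
  assumes "F \<in> cover_ideal (compl_graph E)"
  obtains f F' where "f \<in> log_coeffs E" "Q * F' = (\<Sum>i\<in>UNIV. f i * (\<Prod>j\<in>-{i}. Var j))"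
    "(\<Prod>i\<in>UNIV. Var i) dvd F - F'"
proof -
  obtain f where f: "f \<in> log_coeffs E"
    "\<And>u. f u * (\<Prod>j\<in>-{u}. Var j - Var u) = Q * psubst (\<lambda>j. Var j - Var u) F"
    using ex_log_coeffs [OF assms] by blast
  from Q_dvd_sum [OF f(1)] obtain F' where "(\<Sum>i\<in>UNIV. f i * (\<Prod>j\<in>-{i}. Var j)) = Q * F'"
    by (rule dvdE)
  note F' = this [symmetric]
  have "Var u dvd F - F'" for u
  proof -
    have "psubst (\<lambda>j. Var j - Var u) Q = Q"
      using Q_in_diff_ring by (simp add: in_diff_ring_iff [of _ u])
    then have "Q * psubst (\<lambda>j. Var j - Var u) F' = Q * psubst (\<lambda>j. Var j - Var u) F"
      using psubst_shift_sum [OF F', of u] f by (simp add: log_coeffs_def)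
    then show ?thesis
      by (simp add: Var_dvd_iff)
  qed
  then have "(\<Prod>i\<in>UNIV. Var i) dvd F - F'"
    by (intro prod_primes_dvd prime_elem_Var) auto
  then show ?thesis
    using that f(1) F' by blast
qed

end

section \<open>The isomorphism\<close>

text \<open>Covers modules whose operations are those of a type. Negation is multiplication by
  \<open>- 1\<close>, which lies in \<open>R\<close>, so closure under scalars provides it.\<close>

lemma module_diff_ringI:
  fixes M :: "(('k::field, 'n::{finite,linorder}) mpol, 'b::ab_group_add, 'm) module_scheme"
  assumes add: "\<And>x y. x \<oplus>\<^bsub>M\<^esub> y = x + y" and zero: "\<zero>\<^bsub>M\<^esub> = 0"
    and closed: "0 \<in> carrier M"
      "\<And>x y. x \<in> carrier M \<Longrightarrow> y \<in> carrier M \<Longrightarrow> x + y \<in> carrier M"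
      "\<And>r x. r \<in> carrier diff_ring \<Longrightarrow> x \<in> carrier M \<Longrightarrow> r \<odot>\<^bsub>M\<^esub> x \<in> carrier M"
    and smult: "\<And>r s x. (r + s) \<odot>\<^bsub>M\<^esub> x = r \<odot>\<^bsub>M\<^esub> x + s \<odot>\<^bsub>M\<^esub> x"
      "\<And>r x y. r \<odot>\<^bsub>M\<^esub> (x + y) = r \<odot>\<^bsub>M\<^esub> x + r \<odot>\<^bsub>M\<^esub> y"
      "\<And>r s x. (r * s) \<odot>\<^bsub>M\<^esub> x = r \<odot>\<^bsub>M\<^esub> (s \<odot>\<^bsub>M\<^esub> x)"
      "\<And>x. 1 \<odot>\<^bsub>M\<^esub> x = x"
  shows "Module.module diff_ring M"
proof (rule moduleI [OF cring_diff_ring])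
  have inv: "(- 1) \<odot>\<^bsub>M\<^esub> x \<in> carrier M \<and> (- 1) \<odot>\<^bsub>M\<^esub> x + x = 0" if "x \<in> carrier M" for x
  proof
    show "(- 1) \<odot>\<^bsub>M\<^esub> x \<in> carrier M"
      using Const_in_diff_ring [of "- 1"] that by (intro closed) (simp_all add: Const_uminus)
    have "0 \<odot>\<^bsub>M\<^esub> x = 0"
      using smult(1) [of 0 0 x] by simp
    then show "(- 1) \<odot>\<^bsub>M\<^esub> x + x = 0"
      using smult(1) [of "- 1" 1 x] by (simp add: smult(4))
  qed
  show "abelian_group M"
    by (rule abelian_groupI) (use inv in \<open>auto simp: add zero closed ac_simps\<close>)
qed (simp_all add: add closed smult)

lemma in_cover_ideal_iff:
  fixes F :: "('k::field, 'n::{finite,linorder}) mpol"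
  shows "F \<in> cover_ideal G \<longleftrightarrow> (\<forall>e\<in>G. psubst (\<lambda>i. if i \<in> e then 0 else Var i) F = 0)"
  by (simp add: cover_ideal_def in_genideal_Var_iff)

lemma cover_module_simps [simp]:
  "carrier (cover_module G) = cover_ideal G"
  "x \<oplus>\<^bsub>cover_module G\<^esub> y = x + y"
  "\<zero>\<^bsub>cover_module G\<^esub> = 0"
  "r \<odot>\<^bsub>cover_module G\<^esub> x = r * x"
  by (simp_all add: cover_module_def)

lemma log_module_R_simps [simp]:
  "carrier (log_module_R A \<alpha>) = log_forms_R A \<alpha>"
  "x \<oplus>\<^bsub>log_module_R A \<alpha>\<^esub> y = x + y"
  "\<zero>\<^bsub>log_module_R A \<alpha>\<^esub> = 0"
  "r \<odot>\<^bsub>log_module_R A \<alpha>\<^esub> x = to_fract r *s x"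
  by (simp_all add: log_module_R_def)

lemma module_cover_module:
  "Module.module diff_ring (cover_module G :: (('k::field, 'n::{finite,linorder}) mpol, _) module)"
  by (rule module_diff_ringI) (simp_all add: in_cover_ideal_iff algebra_simps)

text \<open>The coset of \<open>F\<close> is its congruence class modulo \<open>d\<close>, which
  turns equality in the quotient into divisibility.\<close>

lemma a_r_coset_cover_module_eq_iff:
  fixes F F' :: "('k::field, 'n::{finite,linorder}) mpol"
  shows "PIdl\<^bsub>mpol_ring\<^esub> d +>\<^bsub>cover_module G\<^esub> F = PIdl\<^bsub>mpol_ring\<^esub> d +>\<^bsub>cover_module G\<^esub> F' \<longleftrightarrow>
    d dvd F - F'"
proof -
  have mem: "p \<in> PIdl\<^bsub>mpol_ring\<^esub> d +>\<^bsub>cover_module G\<^esub> F \<longleftrightarrow> d dvd p - F" for p F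
    by (auto simp: a_r_coset_def' intro!: bexI [of _ "p - F"])
  have "d dvd p - F \<longleftrightarrow> d dvd p - F'" if "d dvd F - F'" for p
    using dvd_add_right_iff [OF that, of "p - F"] by simp
  moreover have "d dvd F - F'" if "\<forall>p. d dvd p - F \<longleftrightarrow> d dvd p - F'"
    using spec [OF that, of F] by simp
  ultimately show ?thesis
    unfolding set_eq_iff mem by blast
qed

text \<open>A non-edge is nonempty, so setting its variables to zero kills
  \<open>x_1 \<cdots> x_\<ell>\<close>.\<close>

lemma submodule_prod_Var:
  "submodule (PIdl\<^bsub>mpol_ring\<^esub> (\<Prod>i\<in>UNIV. Var i)) diff_ring
    (cover_module (compl_graph E) :: (('k::field, 'n::{finite,linorder}) mpol, _) module)"
proof -
  interpret Module.module diff_ring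
    "cover_module (compl_graph E) :: (('k::field, 'n::{finite,linorder}) mpol, _) module"
    by (rule module_cover_module)
  have "psubst (\<lambda>i. if i \<in> e then 0 else Var i) (\<Prod>i\<in>UNIV. Var i) = (0 :: ('k, 'n) mpol)"
    if "e \<in> compl_graph E" for e
  proof -
    have "e \<noteq> {}" using that by (auto simp: compl_graph_def)
    then show ?thesis by auto
  qed
  then have sub: "p \<in> cover_ideal (compl_graph E)" if "(\<Prod>i\<in>UNIV. Var i) dvd p" for p :: "('k, 'n) mpol"
    using that by (auto simp: in_cover_ideal_iff simp del: psubst_prod elim!: dvdE)
  \<comment> \<open>Negation in the module record is determined only on the carrier, so membership
    in the cover ideal has to come first.\<close>
  have "\<ominus>\<^bsub>cover_module (compl_graph E)\<^esub> p = - p" if "(\<Prod>i\<in>UNIV. Var i) dvd p" for p :: "('k, 'n) mpol"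
    using that by (intro M.minus_equality) (auto intro!: sub)
  then show ?thesis
    by (intro submoduleI) (auto intro: sub)
qed

section \<open>The module of logarithmic forms and the contraction map\<close>

context graphic
begin

lemma module_log_module_R: "Module.module diff_ring (log_module_R arr \<alpha>)"
proof (rule module_diff_ringI)
  show "0 \<in> carrier (log_module_R arr \<alpha>)"
    using Const_in_diff_ring [of 0]
    by (auto simp: in_log_forms_R_iff log_coeffs_def vec_eq_iff intro!: bexI [of _ "\<lambda>_. 0"])
next
  fix x y assume "x \<in> carrier (log_module_R arr \<alpha>)" "y \<in> carrier (log_module_R arr \<alpha>)"
  then obtain f g where "f \<in> log_coeffs E" "g \<in> log_coeffs E"
    and xy: "x = (\<chi> i. to_fract (f i) / to_fract Q)" "y = (\<chi> i. to_fract (g i) / to_fract Q)"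
    by (auto simp: in_log_forms_R_iff)
  then have "(\<lambda>i. f i + g i) \<in> log_coeffs E"
    \<comment> \<open>Regroups the edge condition of the sum as
      \<open>(f u + f v) + (g u + g v)\<close>.\<close>
    using dvd_add [of _ "f _ + f _" "g _ + g _"]
    by (auto simp: log_coeffs_def add_in_diff_ring algebra_simps)
  then show "x + y \<in> carrier (log_module_R arr \<alpha>)"
    unfolding log_module_R_simps in_log_forms_R_iff
    by (rule rev_bexI) (simp add: xy vec_eq_iff add_divide_distrib)
next
  fix r :: "('k, 'n) mpol" and x assume r: "r \<in> carrier diff_ring" and "x \<in> carrier (log_module_R arr \<alpha>)"
  then obtain f where f: "f \<in> log_coeffs E" "x = (\<chi> i. to_fract (f i) / to_fract Q)"
    by (auto simp: in_log_forms_R_iff)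
  then have "(\<lambda>i. r * f i) \<in> log_coeffs E"
    using r by (auto simp: log_coeffs_def mult_in_diff_ring simp flip: distrib_left)
  then show "r \<odot>\<^bsub>log_module_R arr \<alpha>\<^esub> x \<in> carrier (log_module_R arr \<alpha>)"
    unfolding log_module_R_simps in_log_forms_R_iff
    by (rule rev_bexI) (simp add: f vec_eq_iff)
qed (simp_all add: vec_eq_iff algebra_simps)

text \<open>The pairing of \<open>\<omega>\<close> with the derivation
  \<open>\<Sum>i. (\<Prod>j\<noteq>i. x_j) \<partial>/\<partial>x_i\<close>.\<close>

definition fract_contraction :: "('k, 'n) rat_form1 \<Rightarrow> ('k, 'n) mpol fract"
  where "fract_contraction \<omega> = (\<Sum>i\<in>UNIV. \<omega> $ i * to_fract (\<Prod>j\<in>-{i}. Var j))"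

text \<open>Meaningful when the pairing is a polynomial, as on \<open>log_forms_R\<close>;
  uniqueness comes from the injectivity of \<open>to_fract\<close>.\<close>

definition contraction :: "('k, 'n) rat_form1 \<Rightarrow> ('k, 'n) mpol"
  where "contraction \<omega> = (THE F. to_fract F = fract_contraction \<omega>)"

lemma fract_contraction_eq_iff:
  "to_fract F = fract_contraction (\<chi> i. to_fract (f i) / to_fract Q) \<longleftrightarrow>
    Q * F = (\<Sum>i\<in>UNIV. f i * (\<Prod>j\<in>-{i}. Var j))"
proof -
  have *: "fract_contraction (\<chi> i. to_fract (f i) / to_fract Q) =
      to_fract (\<Sum>i\<in>UNIV. f i * (\<Prod>j\<in>-{i}. Var j)) / to_fract Q"
    by (simp add: fract_contraction_def sum_divide_distrib)
  have "to_fract F = fract_contraction (\<chi> i. to_fract (f i) / to_fract Q) \<longleftrightarrow>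
      to_fract (Q * F) = to_fract (\<Sum>i\<in>UNIV. f i * (\<Prod>j\<in>-{i}. Var j))"
    unfolding * by (simp only: nonzero_eq_divide_eq to_fract_eq_0_iff Q_neq_0 not_False_eq_True to_fract_mult mult.commute)
  then show ?thesis
    by (simp only: to_fract_eq_iff)
qed

lemma contraction_eqI:
  assumes "to_fract F = fract_contraction \<omega>"
  shows "contraction \<omega> = F"
  unfolding contraction_def assms [symmetric] by simp

lemma to_fract_contraction:
  assumes "\<omega> \<in> log_forms_R arr \<alpha>"
  shows "to_fract (contraction \<omega>) = fract_contraction \<omega>"
proof -
  obtain f where f: "f \<in> log_coeffs E" "\<omega> = (\<chi> i. to_fract (f i) / to_fract Q)"
    using assms by (auto simp: in_log_forms_R_iff)
  from Q_dvd_sum [OF f(1)] obtain F where "(\<Sum>i\<in>UNIV. f i * (\<Prod>j\<in>-{i}. Var j)) = Q * F"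
    by (rule dvdE)
  then have "to_fract F = fract_contraction \<omega>"
    unfolding f(2) fract_contraction_eq_iff by simp
  then show ?thesis
    using contraction_eqI by metis
qed

lemma contraction_in_cover_ideal:
  assumes "\<omega> \<in> log_forms_R arr \<alpha>"
  shows "contraction \<omega> \<in> cover_ideal (compl_graph E)"
  using assms to_fract_contraction [OF assms]
  by (auto simp: in_log_forms_R_iff fract_contraction_eq_iff intro: in_cover_ideal_if_sum)

lemma contraction_add:
  assumes "x \<in> log_forms_R arr \<alpha>" "y \<in> log_forms_R arr \<alpha>"
  shows "contraction (x + y) = contraction x + contraction y"
  by (rule contraction_eqI)
    (simp add: to_fract_contraction assms, simp add: fract_contraction_def distrib_right sum.distrib)

lemma contraction_smult:
  assumes "x \<in> log_forms_R arr \<alpha>"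
  shows "contraction (to_fract r *s x) = r * contraction x"
  by (rule contraction_eqI)
    (simp add: to_fract_contraction assms, simp add: fract_contraction_def sum_distrib_left mult.assoc)

text \<open>The kernel of the induced map to the quotient is trivial.\<close>

lemma eq_0_if_dvd_contraction:
  assumes \<omega>: "\<omega> \<in> log_forms_R arr \<alpha>" and dvd: "(\<Prod>i\<in>UNIV. Var i) dvd contraction \<omega>"
  shows "\<omega> = 0"
proof -
  obtain f where f: "f \<in> log_coeffs E" "\<omega> = (\<chi> i. to_fract (f i) / to_fract Q)"
    using \<omega> by (auto simp: in_log_forms_R_iff)
  have "f u = 0" for u
  proof (rule coeffs_eq_0_if_prod_Var_dvd [OF _ _ dvd])
    show "Q * contraction \<omega> = (\<Sum>i\<in>UNIV. f i * (\<Prod>j\<in>-{i}. Var j))"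
      using to_fract_contraction [OF \<omega>] unfolding f(2) fract_contraction_eq_iff .
    show "f u \<in> carrier diff_ring"
      using f(1) by (simp add: log_coeffs_def)
  qed
  then show ?thesis
    by (simp add: f(2) vec_eq_iff)
qed

text \<open>The induced map to the quotient is surjective: the interpolated numerators provide the
  preimage.\<close>

lemma ex_contraction_cong:
  assumes "F \<in> cover_ideal (compl_graph E)"
  obtains \<omega> where "\<omega> \<in> log_forms_R arr \<alpha>" "(\<Prod>i\<in>UNIV. Var i) dvd F - contraction \<omega>"
proof -
  obtain f F' where f: "f \<in> log_coeffs E" "Q * F' = (\<Sum>i\<in>UNIV. f i * (\<Prod>j\<in>-{i}. Var j))"
    "(\<Prod>i\<in>UNIV. Var i) dvd F - F'"
    using ex_log_coeffs_cong [OF assms] .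
  then have "contraction (\<chi> i. to_fract (f i) / to_fract Q) = F'"
    by (intro contraction_eqI) (simp add: fract_contraction_eq_iff)
  then show ?thesis
    using that f in_log_forms_R_iff by blast
qed

lemma log_module_R_isomorphic:
  "module_isomorphic (diff_ring :: ('k, 'n) mpol ring) (log_module_R arr \<alpha>)
    (quot_module (cover_module (compl_graph E)) (PIdl\<^bsub>mpol_ring\<^esub> (\<Prod>i\<in>UNIV. Var i)))"
    (is "module_isomorphic _ ?L (quot_module ?C ?N)")
proof -
  interpret L: Module.module diff_ring ?L
    by (rule module_log_module_R)
  interpret C: Module.module diff_ring ?C
    by (rule module_cover_module)
  note sub = submodule_prod_Var [of E, where ?'k = 'k]
  note C = C.quot_module_simps [of ?N] C.quot_module_add [OF sub] C.quot_module_smult [OF sub]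
  let ?h = "\<lambda>\<omega>. ?N +>\<^bsub>?C\<^esub> contraction \<omega>"
  have "inj_on ?h (carrier ?L)"
  proof (rule inj_onI)
    fix x y assume xy: "x \<in> carrier ?L" "y \<in> carrier ?L" "?h x = ?h y"
    \<comment> \<open>Writing negation as a scalar multiple makes closure and linearity available
      for differences, reducing injectivity to the trivial kernel.\<close>
    have "- y = to_fract (- 1) *s y"
      by (simp add: vec_eq_iff)
    then have y: "- y \<in> log_forms_R arr \<alpha>" "contraction (- y) = - contraction y"
      using L.smult_closed [of "- 1" y] Const_in_diff_ring [of "- 1"] xy(2) contraction_smult [of y "- 1"]
      by (simp_all add: Const_uminus del: to_fract_uminus)
    have "x - y \<in> log_forms_R arr \<alpha>" "contraction (x - y) = contraction x - contraction y"
      using L.a_closed [of x "- y"] contraction_add [of x "- y"] xy y by simp_all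
    then have "x - y = 0"
      using xy(3) by (intro eq_0_if_dvd_contraction) (simp_all add: a_r_coset_cover_module_eq_iff)
    then show "x = y" by simp
  qed
  moreover have "?h ` carrier ?L = carrier (quot_module ?C ?N)"
  proof -
    have "?N +>\<^bsub>?C\<^esub> F \<in> ?h ` carrier ?L" if F: "F \<in> cover_ideal (compl_graph E)" for F
    proof -
      from ex_contraction_cong [OF F] obtain \<omega> where
        "\<omega> \<in> log_forms_R arr \<alpha>" "(\<Prod>i\<in>UNIV. Var i) dvd F - contraction \<omega>" .
      then show ?thesis
        by (intro image_eqI [of _ _ \<omega>]) (simp_all add: a_r_coset_cover_module_eq_iff)
    qed
    then show ?thesis
      by (auto simp: C contraction_in_cover_ideal)
  qed
  ultimately have "?h \<in> module_iso diff_ring ?L (quot_module ?C ?N)"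
    by (auto simp: module_iso_def bij_betw_def C contraction_in_cover_ideal contraction_add contraction_smult)
  then show ?thesis
    using L.module_axioms C.quot_module_is_module [OF sub] unfolding module_isomorphic_def by blast
qed

end

theorem theorem1p5:
  fixes E :: "'n::{finite,linorder} set set"
    and \<alpha> :: "('k::field, 'n) vect set \<Rightarrow> ('k, 'n) vect"
  assumes "simple_graph E"
    and "graphic_forms E \<alpha>"
  shows "module_isomorphic (diff_ring :: ('k, 'n) mpol ring)
    (log_module_R (graphic_arrangement E) \<alpha>)
    (quot_module (cover_module (compl_graph E)) (PIdl\<^bsub>mpol_ring\<^esub> (\<Prod>i\<in>UNIV. Var i)))"
  using assms by (intro graphic.log_module_R_isomorphic graphic.intro)

end
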